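(* The monoid algebra $\mathbb{C}R_n^0$, viewed as a left $H_n^0$-module by left multiplication, is projective. As a consequence, every projective $R_n^0$-module remains projective when restricted to $H_n^0$.
   Context: $R_n^0$ is the monoid presented by generators $\pi_0,\dots,\pi_{n-1}$ and relations $\pi_i^2=\pi_i$ ($0\le i\le n-1$), $\pi_i\pi_{i+1}\pi_i=\pi_{i+1}\pi_i\pi_{i+1}$ ($1\le i\le n-2$), $\pi_1\pi_0\pi_1\pi_0=\pi_0\pi_1\pi_0=\pi_0\pi_1\pi_0\pi_1$, $\pi_i\pi_j=\pi_j\pi_i$ ($0\le i,j\le n-1$, $|i-j|\ge2$). $H_n^0$ is the submonoid generated by $\pi_1,\dots,\pi_{n-1}$ (the $0$-Hecke monoid of $\mathfrak{S}_n$). Modules are over the complex monoid algebras. *)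

theory Defs
  imports Complex_Main "HOL-Algebra.Module" "HOL-Algebra.AbelCoset"
begin

section \<open>Presented monoids\<close>

text \<open>
  The monoid presented by a set of generators \<open>S\<close> and a set of relations \<open>E\<close>: words over \<open>S\<close>
  modulo the least monoid congruence containing \<open>E\<close> (where \<open>E\<close> relates words over \<open>S\<close>).
\<close>

inductive presented_eq :: "'g set \<Rightarrow> ('g list \<times> 'g list) set \<Rightarrow> 'g list \<Rightarrow> 'g list \<Rightarrow> bool"
  for S E where
  word_refl: "u \<in> lists S \<Longrightarrow> presented_eq S E u u"
| word_rel: "(u, v) \<in> E \<Longrightarrow> presented_eq S E u v"
| word_sym: "presented_eq S E u v \<Longrightarrow> presented_eq S E v u"
| word_trans: "presented_eq S E u v \<Longrightarrow> presented_eq S E v w \<Longrightarrow> presented_eq S E u w"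
| word_mult: "presented_eq S E u v \<Longrightarrow> presented_eq S E u' v' \<Longrightarrow> presented_eq S E (u @ u') (v @ v')"

definition word_class :: "'g set \<Rightarrow> ('g list \<times> 'g list) set \<Rightarrow> 'g list \<Rightarrow> 'g list set" where
  "word_class S E u = {v. presented_eq S E u v}"

definition presented_monoid :: "'g set \<Rightarrow> ('g list \<times> 'g list) set \<Rightarrow> 'g list set monoid" where
  "presented_monoid S E =
    \<lparr>carrier = word_class S E ` lists S,
     mult = (\<lambda>A B. \<Union>a\<in>A. \<Union>b\<in>B. word_class S E (a @ b)),
     one = word_class S E []\<rparr>"

definition generated_submonoid :: "('m, 'k) monoid_scheme \<Rightarrow> 'm set \<Rightarrow> ('m, 'k) monoid_scheme" where
  "generated_submonoid M S = M\<lparr>carrier := \<Inter>{H. submonoid H M \<and> S \<subseteq> H}\<rparr>"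

section \<open>The 0-rook monoid and the 0-Hecke monoid\<close>

definition rook_relations :: "nat \<Rightarrow> (nat list \<times> nat list) set" where
  "rook_relations n =
     {([i, i], [i]) | i. i < n}
   \<union> {([i, i + 1, i], [i + 1, i, i + 1]) | i. 1 \<le> i \<and> i + 1 < n}
   \<union> (if 1 < n then {([1, 0, 1, 0], [0, 1, 0]), ([0, 1, 0], [0, 1, 0, 1])} else {})
   \<union> {([i, j], [j, i]) | i j. i < n \<and> j < n \<and> (i + 2 \<le> j \<or> j + 2 \<le> i)}"

definition rook_monoid :: "nat \<Rightarrow> nat list set monoid" where
  "rook_monoid n = presented_monoid {..<n} (rook_relations n)"

definition rook_gen :: "nat \<Rightarrow> nat \<Rightarrow> nat list set" where
  "rook_gen n i = word_class {..<n} (rook_relations n) [i]"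

definition hecke_monoid :: "nat \<Rightarrow> nat list set monoid" where
  "hecke_monoid n = generated_submonoid (rook_monoid n) {rook_gen n i | i. 1 \<le> i \<and> i < n}"

section \<open>Complex monoid algebras\<close>

text \<open>
  An element of the monoid algebra is a finitely supported function on the whole type that
  vanishes off the monoid. So the algebra of a submonoid is literally a subset of the algebra of
  the monoid, with the same operations.
\<close>

definition monoid_algebra :: "('m, 'k) monoid_scheme \<Rightarrow> ('m \<Rightarrow> complex) ring" where
  "monoid_algebra M =
    \<lparr>carrier = {f. {x. f x \<noteq> 0} \<subseteq> carrier M \<and> finite {x. f x \<noteq> 0}},
     mult = (\<lambda>f g x. \<Sum>y | f y \<noteq> 0. \<Sum>z | g z \<noteq> 0. if y \<otimes>\<^bsub>M\<^esub> z = x then f y * g z else 0),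
     one = (\<lambda>x. if x = \<one>\<^bsub>M\<^esub> then 1 else 0),
     zero = (\<lambda>_. 0),
     add = (\<lambda>f g x. f x + g x)\<rparr>"

abbreviation rook_algebra :: "nat \<Rightarrow> (nat list set \<Rightarrow> complex) ring" where
  "rook_algebra n \<equiv> monoid_algebra (rook_monoid n)"

abbreviation hecke_algebra :: "nat \<Rightarrow> (nat list set \<Rightarrow> complex) ring" where
  "hecke_algebra n \<equiv> monoid_algebra (hecke_monoid n)"

section \<open>Left modules over a ring that need not be commutative\<close>

text \<open>
  As the library's locale \<^locale>\<open>module\<close>, but over an arbitrary ring. The \<open>mult\<close> and \<open>one\<close> fields
  of the record play no role. Since the scalars enter only through the carrier and
  the operations of \<open>R\<close>, restricting scalars to a subring does not change the record \<open>M\<close>.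
\<close>

locale left_module = R?: ring + M?: abelian_group M for M (structure) +
  assumes smult_closed [simp, intro]:
      "\<lbrakk>a \<in> carrier R; x \<in> carrier M\<rbrakk> \<Longrightarrow> a \<odot>\<^bsub>M\<^esub> x \<in> carrier M"
    and smult_l_distr:
      "\<lbrakk>a \<in> carrier R; b \<in> carrier R; x \<in> carrier M\<rbrakk> \<Longrightarrow>
      (a \<oplus> b) \<odot>\<^bsub>M\<^esub> x = a \<odot>\<^bsub>M\<^esub> x \<oplus>\<^bsub>M\<^esub> b \<odot>\<^bsub>M\<^esub> x"
    and smult_r_distr:
      "\<lbrakk>a \<in> carrier R; x \<in> carrier M; y \<in> carrier M\<rbrakk> \<Longrightarrow>
      a \<odot>\<^bsub>M\<^esub> (x \<oplus>\<^bsub>M\<^esub> y) = a \<odot>\<^bsub>M\<^esub> x \<oplus>\<^bsub>M\<^esub> a \<odot>\<^bsub>M\<^esub> y"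
    and smult_assoc1:
      "\<lbrakk>a \<in> carrier R; b \<in> carrier R; x \<in> carrier M\<rbrakk> \<Longrightarrow>
      (a \<otimes> b) \<odot>\<^bsub>M\<^esub> x = a \<odot>\<^bsub>M\<^esub> (b \<odot>\<^bsub>M\<^esub> x)"
    and smult_one [simp]: "x \<in> carrier M \<Longrightarrow> \<one> \<odot>\<^bsub>M\<^esub> x = x"

definition regular_module :: "('r, 'k) ring_scheme \<Rightarrow> ('r, 'r) module" where
  "regular_module R =
    \<lparr>carrier = carrier R, mult = mult R, one = one R, zero = zero R, add = add R, smult = mult R\<rparr>"

definition left_module_hom ::
    "('r, 'k) ring_scheme \<Rightarrow> ('r, 'm, 'j) module_scheme \<Rightarrow> ('r, 'n, 'l) module_scheme \<Rightarrow> ('m \<Rightarrow> 'n) set" where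
  "left_module_hom R M N =
    {h \<in> carrier M \<rightarrow> carrier N.
      (\<forall>x\<in>carrier M. \<forall>y\<in>carrier M. h (x \<oplus>\<^bsub>M\<^esub> y) = h x \<oplus>\<^bsub>N\<^esub> h y) \<and>
      (\<forall>a\<in>carrier R. \<forall>x\<in>carrier M. h (a \<odot>\<^bsub>M\<^esub> x) = a \<odot>\<^bsub>N\<^esub> h x)}"

definition module_isomorphic ::
    "('r, 'k) ring_scheme \<Rightarrow> ('r, 'm, 'j) module_scheme \<Rightarrow> ('r, 'n, 'l) module_scheme \<Rightarrow> bool" where
  "module_isomorphic R M N \<longleftrightarrow> (\<exists>h \<in> left_module_hom R M N. bij_betw h (carrier M) (carrier N))"

text \<open>The free left module on \<open>X\<close>: finitely supported functions from \<open>X\<close> to \<open>R\<close>.\<close>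

definition free_module :: "('r, 'k) ring_scheme \<Rightarrow> 'x set \<Rightarrow> ('r, 'x \<Rightarrow> 'r) module" where
  "free_module R X =
    \<lparr>carrier = {v. (\<forall>x\<in>X. v x \<in> carrier R) \<and> (\<forall>x. x \<notin> X \<longrightarrow> v x = \<zero>\<^bsub>R\<^esub>) \<and> finite {x. v x \<noteq> \<zero>\<^bsub>R\<^esub>}},
     mult = undefined, one = undefined,
     zero = (\<lambda>_. \<zero>\<^bsub>R\<^esub>),
     add = (\<lambda>v w x. v x \<oplus>\<^bsub>R\<^esub> w x),
     smult = (\<lambda>a v x. a \<otimes>\<^bsub>R\<^esub> v x)\<rparr>"

definition direct_summand ::
    "('r, 'k) ring_scheme \<Rightarrow> 'm set \<Rightarrow> ('r, 'm, 'j) module_scheme \<Rightarrow> bool" where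
  "direct_summand R A M \<longleftrightarrow> submodule A R M \<and>
    (\<exists>B. submodule B R M \<and> A \<inter> B = {\<zero>\<^bsub>M\<^esub>} \<and> A <+>\<^bsub>M\<^esub> B = carrier M)"

text \<open>
  A module is projective if it is isomorphic to a direct summand of a free module. The basis \<open>X\<close>
  is taken in the type of the elements of \<open>P\<close>; this is no restriction, as a projective module is a
  summand of the free module on its own carrier. See \<open>projective_module_lift\<close> and
  \<open>projective_moduleI\<close> below for the equivalence with the lifting property.
\<close>

definition projective_module :: "('r, 'k) ring_scheme \<Rightarrow> ('r, 'p, 'j) module_scheme \<Rightarrow> bool" where
  "projective_module R P \<longleftrightarrow> left_module R P \<and>
    (\<exists>(X :: 'p set) A. direct_summand R A (free_module R X) \<and>
       module_isomorphic R P ((free_module R X)\<lparr>carrier := A\<rparr>))"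

subsection \<open>Equivalence with the lifting property\<close>

context left_module
begin

lemma smult_l_null [simp]: "x \<in> carrier M \<Longrightarrow> \<zero> \<odot>\<^bsub>M\<^esub> x = \<zero>\<^bsub>M\<^esub>"
  by (metis M.add.r_cancel_one' R.add.l_one R.zero_closed smult_closed smult_l_distr)

lemma smult_r_null [simp]: "a \<in> carrier R \<Longrightarrow> a \<odot>\<^bsub>M\<^esub> \<zero>\<^bsub>M\<^esub> = \<zero>\<^bsub>M\<^esub>"
  by (metis M.add.r_cancel_one' M.add.l_one M.zero_closed smult_closed smult_r_distr)

lemma smult_r_minus:
  assumes "a \<in> carrier R" "x \<in> carrier M"
  shows "a \<odot>\<^bsub>M\<^esub> (\<ominus>\<^bsub>M\<^esub> x) = \<ominus>\<^bsub>M\<^esub> (a \<odot>\<^bsub>M\<^esub> x)"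
  using assms by (metis M.add.inv_closed M.minus_equality M.l_neg smult_closed smult_r_distr smult_r_null)

lemma finsum_smult:
  assumes "finite A" "a \<in> carrier R" "f \<in> A \<rightarrow> carrier M"
  shows "a \<odot>\<^bsub>M\<^esub> finsum M f A = (\<Oplus>\<^bsub>M\<^esub>i\<in>A. a \<odot>\<^bsub>M\<^esub> f i)"
  using assms by (induct set: finite) (simp_all add: Pi_def smult_r_distr)

end

lemma left_module_hom_zero:
  assumes "left_module R M" "left_module R N" "h \<in> left_module_hom R M N"
  shows "h \<zero>\<^bsub>M\<^esub> = \<zero>\<^bsub>N\<^esub>"
proof -
  interpret M: left_module R M by fact
  interpret N: left_module R N by fact
  have "h \<zero>\<^bsub>M\<^esub> = h (\<zero>\<^bsub>R\<^esub> \<odot>\<^bsub>M\<^esub> \<zero>\<^bsub>M\<^esub>)" by simp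
  also have "\<dots> = \<zero>\<^bsub>R\<^esub> \<odot>\<^bsub>N\<^esub> h \<zero>\<^bsub>M\<^esub>"
    using assms(3) M.M.zero_closed M.R.zero_closed unfolding left_module_hom_def by blast
  also have "\<dots> = \<zero>\<^bsub>N\<^esub>"
    using assms(3) by (intro N.smult_l_null) (auto simp: left_module_hom_def Pi_iff)
  finally show ?thesis .
qed

lemma left_module_hom_compose:
  assumes "f \<in> left_module_hom R L M" "g \<in> left_module_hom R M N"
  shows "(\<lambda>x. g (f x)) \<in> left_module_hom R L N"
  using assms unfolding left_module_hom_def by (auto simp: Pi_iff)

lemma left_module_hom_finsum:
  assumes "left_module R M" "left_module R N" "h \<in> left_module_hom R M N"
    and "finite A" "f \<in> A \<rightarrow> carrier M"
  shows "h (finsum M f A) = (\<Oplus>\<^bsub>N\<^esub>i\<in>A. h (f i))"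
proof -
  interpret M: left_module R M by fact
  interpret N: left_module R N by fact
  show ?thesis using assms(4,5)
  proof (induct set: finite)
    case empty
    then show ?case using left_module_hom_zero[OF assms(1-3)] by simp
  next
    case (insert a A)
    have "h (finsum M f (insert a A)) = h (f a \<oplus>\<^bsub>M\<^esub> finsum M f A)"
      using insert by (simp add: Pi_iff)
    also have "\<dots> = h (f a) \<oplus>\<^bsub>N\<^esub> h (finsum M f A)"
      using insert assms(3) M.M.finsum_closed[of f A] unfolding left_module_hom_def by (simp add: Pi_iff)
    also have "\<dots> = (\<Oplus>\<^bsub>N\<^esub>i\<in>insert a A. h (f i))"
      using insert assms(3) by (subst N.M.finsum_insert) (auto simp: left_module_hom_def Pi_iff)
    finally show ?case .
  qed
qed

lemma left_module_free_module:
  assumes "ring R" shows "left_module R (free_module R X)"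
proof -
  interpret ring R by fact
  have fin_add: "finite {x. v x \<oplus>\<^bsub>R\<^esub> w x \<noteq> \<zero>\<^bsub>R\<^esub>}"
    if "finite {x. v x \<noteq> \<zero>\<^bsub>R\<^esub>}" "finite {x. w x \<noteq> \<zero>\<^bsub>R\<^esub>}" for v w :: "'c \<Rightarrow> 'a"
    by (rule finite_subset[OF _ finite_UnI[OF that]]) auto
  have fin_smult: "finite {x. a \<otimes>\<^bsub>R\<^esub> v x \<noteq> \<zero>\<^bsub>R\<^esub>}"
    if "finite {x. v x \<noteq> \<zero>\<^bsub>R\<^esub>}" "a \<in> carrier R" for a and v :: "'c \<Rightarrow> 'a"
    by (rule finite_subset[OF _ that(1)]) (use that(2) in auto)
  have cl: "v x \<in> carrier R" if "\<forall>x\<in>X. v x \<in> carrier R" "\<forall>x. x \<notin> X \<longrightarrow> v x = \<zero>\<^bsub>R\<^esub>" for v x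
    using that by (cases "x \<in> X") auto
  have ag: "abelian_group (free_module R X)"
  proof (rule abelian_groupI)
    fix v assume v: "v \<in> carrier (free_module R X)"
    show "\<exists>w\<in>carrier (free_module R X). w \<oplus>\<^bsub>free_module R X\<^esub> v = \<zero>\<^bsub>free_module R X\<^esub>"
    proof
      show "(\<lambda>x. \<ominus>\<^bsub>R\<^esub> v x) \<oplus>\<^bsub>free_module R X\<^esub> v = \<zero>\<^bsub>free_module R X\<^esub>"
        using v by (auto simp: free_module_def cl l_neg)
      have "finite {x. \<ominus>\<^bsub>R\<^esub> v x \<noteq> \<zero>\<^bsub>R\<^esub>}"
        by (rule finite_subset[of _ "{x. v x \<noteq> \<zero>\<^bsub>R\<^esub>}"]) (use v in \<open>auto simp: free_module_def\<close>)
      then show "(\<lambda>x. \<ominus>\<^bsub>R\<^esub> v x) \<in> carrier (free_module R X)"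
        using v by (auto simp: free_module_def)
    qed
  qed (auto simp: free_module_def fin_add cl a_ac)
  show ?thesis
    by (intro left_module.intro left_module_axioms.intro assms ag)
      (auto simp: free_module_def fin_smult cl l_distr r_distr m_assoc)
qed

lemma left_module_submodule:
  assumes "left_module R M" "submodule A R M"
  shows "left_module R (M\<lparr>carrier := A\<rparr>)"
proof -
  interpret M: left_module R M by fact
  interpret A: submodule A R M by fact
  have sub: "x \<in> A \<Longrightarrow> x \<in> carrier M" for x using A.subset by auto
  have "\<exists>y\<in>A. y \<oplus>\<^bsub>M\<^esub> x = \<zero>\<^bsub>M\<^esub>" if "x \<in> A" for x
    using A.m_inv_closed[OF that] M.M.l_neg[OF sub[OF that]] by (auto simp: a_inv_def)
  then have "abelian_group (M\<lparr>carrier := A\<rparr>)"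
    using A.m_closed A.one_closed by (intro abelian_groupI) (auto simp: sub M.M.a_ac)
  then show ?thesis
    by (intro left_module.intro left_module_axioms.intro M.R.ring_axioms)
       (auto simp: sub M.smult_l_distr M.smult_r_distr M.smult_assoc1)
qed

definition free_basis :: "('r, 'k) ring_scheme \<Rightarrow> 'x \<Rightarrow> 'x \<Rightarrow> 'r" where
  "free_basis R x = (\<lambda>y. if y = x then \<one>\<^bsub>R\<^esub> else \<zero>\<^bsub>R\<^esub>)"

lemma free_basis_closed: "ring R \<Longrightarrow> x \<in> X \<Longrightarrow> free_basis R x \<in> carrier (free_module R X)"
  by (auto simp: free_basis_def free_module_def ring.ring_simprules)

lemma free_module_eq_finsum:
  assumes "ring R" and v: "v \<in> carrier (free_module R X)"
  shows "v = (\<Oplus>\<^bsub>free_module R X\<^esub>x\<in>{x. v x \<noteq> \<zero>\<^bsub>R\<^esub>}. v x \<odot>\<^bsub>free_module R X\<^esub> free_basis R x)"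
proof -
  interpret R: ring R by fact
  interpret F: left_module R "free_module R X" by (rule left_module_free_module) fact
  have vc: "v x \<in> carrier R" for x using v by (cases "x \<in> X") (auto simp: free_module_def)
  have sX: "{x. v x \<noteq> \<zero>\<^bsub>R\<^esub>} \<subseteq> X" and fin: "finite {x. v x \<noteq> \<zero>\<^bsub>R\<^esub>}" using v by (auto simp: free_module_def)
  let ?F = "free_module R X"
  have *: "(\<Oplus>\<^bsub>?F\<^esub>x\<in>S. v x \<odot>\<^bsub>?F\<^esub> free_basis R x) = (\<lambda>y. if y \<in> S then v y else \<zero>\<^bsub>R\<^esub>)"
    if "finite S" "S \<subseteq> X" for S
    using that
  proof (induct set: finite)
    case empty
    then show ?case unfolding F.M.finsum_empty by (simp add: free_module_def)
  next
    case (insert a S)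
    have "(\<Oplus>\<^bsub>?F\<^esub>x\<in>insert a S. v x \<odot>\<^bsub>?F\<^esub> free_basis R x)
        = v a \<odot>\<^bsub>?F\<^esub> free_basis R a \<oplus>\<^bsub>?F\<^esub> (\<Oplus>\<^bsub>?F\<^esub>x\<in>S. v x \<odot>\<^bsub>?F\<^esub> free_basis R x)"
      using insert by (intro F.M.finsum_insert) (auto intro!: F.smult_closed vc free_basis_closed assms)
    also have "\<dots> = v a \<odot>\<^bsub>?F\<^esub> free_basis R a \<oplus>\<^bsub>?F\<^esub> (\<lambda>y. if y \<in> S then v y else \<zero>\<^bsub>R\<^esub>)"
      using insert by simp
    also have "\<dots> = (\<lambda>y. if y \<in> insert a S then v y else \<zero>\<^bsub>R\<^esub>)"
      using insert vc by (auto simp: free_module_def free_basis_def fun_eq_iff)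
    finally show ?case .
  qed
  show ?thesis unfolding *[OF fin sX] by auto
qed

lemma free_module_universal:
  assumes "left_module R M" and m: "m \<in> X \<rightarrow> carrier M"
  obtains h where "h \<in> left_module_hom R (free_module R X) M" "\<And>x. x \<in> X \<Longrightarrow> h (free_basis R x) = m x"
proof -
  interpret M: left_module R M by fact
  let ?F = "free_module R X"
  interpret F: left_module R ?F by (rule left_module_free_module) (rule M.R.ring_axioms)
  have cl: "v x \<in> carrier R" if "v \<in> carrier ?F" for v x
    using that by (cases "x \<in> X") (auto simp: free_module_def)
  have fin: "finite {x. v x \<noteq> \<zero>\<^bsub>R\<^esub>}" "{x. v x \<noteq> \<zero>\<^bsub>R\<^esub>} \<subseteq> X" if "v \<in> carrier ?F" for v
    using that by (auto simp: free_module_def)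
  define h where "h v = (\<Oplus>\<^bsub>M\<^esub>x\<in>{x. v x \<noteq> \<zero>\<^bsub>R\<^esub>}. v x \<odot>\<^bsub>M\<^esub> m x)" for v
  have mc: "x \<in> X \<Longrightarrow> m x \<in> carrier M" for x using m by auto
  have h: "h v = (\<Oplus>\<^bsub>M\<^esub>x\<in>S. v x \<odot>\<^bsub>M\<^esub> m x)"
    if "v \<in> carrier ?F" "finite S" "S \<subseteq> X" "{x. v x \<noteq> \<zero>\<^bsub>R\<^esub>} \<subseteq> S" for v S
    unfolding h_def using that
    by (intro M.M.add.finprod_mono_neutral_cong_left) (auto intro!: M.smult_closed M.smult_l_null cl mc dest: subsetD)
  have "h \<in> left_module_hom R ?F M"
    unfolding left_module_hom_def
  proof (intro CollectI conjI ballI)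
    show "h \<in> carrier ?F \<rightarrow> carrier M"
      unfolding h_def using fin by (auto intro!: M.M.finsum_closed M.smult_closed cl mc)
  next
    fix v w assume v: "v \<in> carrier ?F" and w: "w \<in> carrier ?F"
    let ?S = "{x. v x \<noteq> \<zero>\<^bsub>R\<^esub>} \<union> {x. w x \<noteq> \<zero>\<^bsub>R\<^esub>}"
    have S: "finite ?S" "?S \<subseteq> X" using fin[OF v] fin[OF w] by auto
    have vw: "v \<oplus>\<^bsub>?F\<^esub> w \<in> carrier ?F" using v w by simp
    have "h (v \<oplus>\<^bsub>?F\<^esub> w) = (\<Oplus>\<^bsub>M\<^esub>x\<in>?S. (v \<oplus>\<^bsub>?F\<^esub> w) x \<odot>\<^bsub>M\<^esub> m x)"
      by (rule h[OF vw S]) (auto simp: free_module_def)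
    also have "\<dots> = (\<Oplus>\<^bsub>M\<^esub>x\<in>?S. v x \<odot>\<^bsub>M\<^esub> m x \<oplus>\<^bsub>M\<^esub> w x \<odot>\<^bsub>M\<^esub> m x)"
    proof (rule M.M.finsum_cong')
      fix x assume "x \<in> ?S"
      then have "x \<in> X" using S by auto
      then show "(v \<oplus>\<^bsub>?F\<^esub> w) x \<odot>\<^bsub>M\<^esub> m x = v x \<odot>\<^bsub>M\<^esub> m x \<oplus>\<^bsub>M\<^esub> w x \<odot>\<^bsub>M\<^esub> m x"
        using M.smult_l_distr[of "v x" "w x" "m x"] cl[OF v] cl[OF w] mc by (simp add: free_module_def)
    next
      show "(\<lambda>x. v x \<odot>\<^bsub>M\<^esub> m x \<oplus>\<^bsub>M\<^esub> w x \<odot>\<^bsub>M\<^esub> m x) \<in> ?S \<rightarrow> carrier M"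
        using S cl[OF v] cl[OF w] mc by (intro funcsetI M.M.add.m_closed M.smult_closed) auto
    qed simp
    also have "\<dots> = (\<Oplus>\<^bsub>M\<^esub>x\<in>?S. v x \<odot>\<^bsub>M\<^esub> m x) \<oplus>\<^bsub>M\<^esub> (\<Oplus>\<^bsub>M\<^esub>x\<in>?S. w x \<odot>\<^bsub>M\<^esub> m x)"
      using S cl[OF v] cl[OF w] mc by (intro M.M.finsum_addf funcsetI M.smult_closed) auto
    also have "\<dots> = h v \<oplus>\<^bsub>M\<^esub> h w" using h[OF v S] h[OF w S] by simp
    finally show "h (v \<oplus>\<^bsub>?F\<^esub> w) = h v \<oplus>\<^bsub>M\<^esub> h w" .
  next
    fix a v assume a: "a \<in> carrier R" and v: "v \<in> carrier ?F"
    let ?S = "{x. v x \<noteq> \<zero>\<^bsub>R\<^esub>}"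
    have av: "a \<odot>\<^bsub>?F\<^esub> v \<in> carrier ?F" using a v by simp
    have "h (a \<odot>\<^bsub>?F\<^esub> v) = (\<Oplus>\<^bsub>M\<^esub>x\<in>?S. (a \<odot>\<^bsub>?F\<^esub> v) x \<odot>\<^bsub>M\<^esub> m x)"
      by (rule h[OF av fin[OF v]]) (use a in \<open>auto simp: free_module_def\<close>)
    also have "\<dots> = (\<Oplus>\<^bsub>M\<^esub>x\<in>?S. a \<odot>\<^bsub>M\<^esub> (v x \<odot>\<^bsub>M\<^esub> m x))"
    proof (rule M.M.finsum_cong')
      fix x assume "x \<in> ?S"
      then have "x \<in> X" using fin[OF v] by auto
      then show "(a \<odot>\<^bsub>?F\<^esub> v) x \<odot>\<^bsub>M\<^esub> m x = a \<odot>\<^bsub>M\<^esub> (v x \<odot>\<^bsub>M\<^esub> m x)"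
        using M.smult_assoc1[OF a, of "v x" "m x"] cl[OF v] mc by (simp add: free_module_def)
    next
      show "(\<lambda>x. a \<odot>\<^bsub>M\<^esub> (v x \<odot>\<^bsub>M\<^esub> m x)) \<in> ?S \<rightarrow> carrier M"
        using a fin[OF v] cl[OF v] mc by (intro funcsetI M.smult_closed) auto
    qed simp
    also have "\<dots> = a \<odot>\<^bsub>M\<^esub> h v"
      unfolding h_def using a fin[OF v] cl[OF v] mc
      by (intro M.finsum_smult[symmetric] funcsetI M.smult_closed) auto
    finally show "h (a \<odot>\<^bsub>?F\<^esub> v) = a \<odot>\<^bsub>M\<^esub> h v" .
  qed
  moreover have "h (free_basis R x) = m x" if "x \<in> X" for x
  proof -
    have "h (free_basis R x) = (\<Oplus>\<^bsub>M\<^esub>y\<in>{x}. free_basis R x y \<odot>\<^bsub>M\<^esub> m y)"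
      using that by (intro h free_basis_closed M.R.ring_axioms) (auto simp: free_basis_def)
    then show ?thesis using mc[OF that] by (simp add: free_basis_def)
  qed
  ultimately show ?thesis using that by blast
qed

lemma free_left_module_hom_eq:
  assumes "left_module R M" "f \<in> left_module_hom R (free_module R X) M" "g \<in> left_module_hom R (free_module R X) M"
    and "\<And>x. x \<in> X \<Longrightarrow> f (free_basis R x) = g (free_basis R x)" and v: "v \<in> carrier (free_module R X)"
  shows "f v = g v"
proof -
  interpret M: left_module R M by fact
  let ?F = "free_module R X"
  note F = left_module_free_module[OF M.R.ring_axioms, of X]
  interpret F: left_module R ?F by fact
  let ?S = "{x. v x \<noteq> \<zero>\<^bsub>R\<^esub>}"
  have S: "finite ?S" "\<And>x. x \<in> ?S \<Longrightarrow> x \<in> X \<and> v x \<in> carrier R"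
    using v by (auto simp: free_module_def)
  have b: "(\<lambda>x. v x \<odot>\<^bsub>?F\<^esub> free_basis R x) \<in> ?S \<rightarrow> carrier ?F"
    using S(2) by (intro funcsetI F.smult_closed free_basis_closed M.R.ring_axioms) auto
  have eq: "h v = (\<Oplus>\<^bsub>M\<^esub>x\<in>?S. v x \<odot>\<^bsub>M\<^esub> h (free_basis R x))" if h: "h \<in> left_module_hom R ?F M" for h
  proof -
    have "h v = (\<Oplus>\<^bsub>M\<^esub>x\<in>?S. h (v x \<odot>\<^bsub>?F\<^esub> free_basis R x))"
      by (subst free_module_eq_finsum[OF M.R.ring_axioms v])
         (rule left_module_hom_finsum[OF F assms(1) h S(1) b])
    also have "\<dots> = (\<Oplus>\<^bsub>M\<^esub>x\<in>?S. v x \<odot>\<^bsub>M\<^esub> h (free_basis R x))"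
    proof (rule M.M.finsum_cong')
      show "(\<lambda>x. v x \<odot>\<^bsub>M\<^esub> h (free_basis R x)) \<in> ?S \<rightarrow> carrier M"
      proof (intro funcsetI M.smult_closed)
        fix x assume "x \<in> ?S"
        then show "v x \<in> carrier R" "h (free_basis R x) \<in> carrier M"
          using S(2) h free_basis_closed[OF M.R.ring_axioms, of x X] by (auto simp: left_module_hom_def)
      qed
      fix x assume "x \<in> ?S"
      then show "h (v x \<odot>\<^bsub>?F\<^esub> free_basis R x) = v x \<odot>\<^bsub>M\<^esub> h (free_basis R x)"
        using S(2) h free_basis_closed[OF M.R.ring_axioms, of x X] by (auto simp: left_module_hom_def)
    qed simp
    finally show ?thesis .
  qed
  show ?thesis unfolding eq[OF assms(2)] eq[OF assms(3)]
    using S(2) assms(3,4) free_basis_closed[OF M.R.ring_axioms, of _ X]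
    by (intro M.M.finsum_cong') (auto simp: left_module_hom_def Pi_iff intro!: M.smult_closed)
qed

lemma direct_summand_projection:
  assumes "left_module R M" "direct_summand R A M"
  obtains p where "p \<in> left_module_hom R M (M\<lparr>carrier := A\<rparr>)" "\<And>a. a \<in> A \<Longrightarrow> p a = a"
proof -
  interpret M: left_module R M by fact
  obtain B where A: "submodule A R M" and B: "submodule B R M"
    and int: "A \<inter> B = {\<zero>\<^bsub>M\<^esub>}" and sum: "A <+>\<^bsub>M\<^esub> B = carrier M"
    using assms(2) unfolding direct_summand_def by blast
  interpret A: submodule A R M by fact
  interpret B: submodule B R M by fact
  have Ac: "x \<in> A \<Longrightarrow> x \<in> carrier M" and Bc: "x \<in> B \<Longrightarrow> x \<in> carrier M" for x
    using A.subset B.subset by auto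
  have Aadd: "x \<in> A \<Longrightarrow> y \<in> A \<Longrightarrow> x \<oplus>\<^bsub>M\<^esub> y \<in> A" and Badd: "x \<in> B \<Longrightarrow> y \<in> B \<Longrightarrow> x \<oplus>\<^bsub>M\<^esub> y \<in> B" for x y
    using A.m_closed B.m_closed by auto
  have Aneg: "x \<in> A \<Longrightarrow> \<ominus>\<^bsub>M\<^esub> x \<in> A" and Bneg: "x \<in> B \<Longrightarrow> \<ominus>\<^bsub>M\<^esub> x \<in> B" for x
    using A.m_inv_closed B.m_inv_closed by (auto simp: a_inv_def)
  have ex: "\<exists>a b. a \<in> A \<and> b \<in> B \<and> x = a \<oplus>\<^bsub>M\<^esub> b" if "x \<in> carrier M" for x
    using that unfolding sum[symmetric] by (auto simp: set_add_def set_mult_def)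
  have uniq: "a = a'" if "a \<in> A" "a' \<in> A" "b \<in> B" "b' \<in> B" "a \<oplus>\<^bsub>M\<^esub> b = a' \<oplus>\<^bsub>M\<^esub> b'" for a a' b b'
  proof -
    have "\<ominus>\<^bsub>M\<^esub> a' \<oplus>\<^bsub>M\<^esub> (a \<oplus>\<^bsub>M\<^esub> b) \<oplus>\<^bsub>M\<^esub> \<ominus>\<^bsub>M\<^esub> b = \<ominus>\<^bsub>M\<^esub> a' \<oplus>\<^bsub>M\<^esub> (a' \<oplus>\<^bsub>M\<^esub> b') \<oplus>\<^bsub>M\<^esub> \<ominus>\<^bsub>M\<^esub> b"
      using that by simp
    then have "\<ominus>\<^bsub>M\<^esub> a' \<oplus>\<^bsub>M\<^esub> a = b' \<oplus>\<^bsub>M\<^esub> \<ominus>\<^bsub>M\<^esub> b"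
      using Ac[OF that(1)] Ac[OF that(2)] Bc[OF that(3)] Bc[OF that(4)]
      by (metis M.M.a_assoc M.M.a_inv_closed M.M.add.m_closed M.M.r_neg M.M.r_neg1 M.M.r_zero)
    moreover have "\<ominus>\<^bsub>M\<^esub> a' \<oplus>\<^bsub>M\<^esub> a \<in> A" "b' \<oplus>\<^bsub>M\<^esub> \<ominus>\<^bsub>M\<^esub> b \<in> B"
      using that Aadd Aneg Badd Bneg by auto
    ultimately have "\<ominus>\<^bsub>M\<^esub> a' \<oplus>\<^bsub>M\<^esub> a = \<zero>\<^bsub>M\<^esub>" using int by auto
    then have "\<ominus>\<^bsub>M\<^esub> a' = \<ominus>\<^bsub>M\<^esub> a" using that Ac by (intro M.M.minus_equality[symmetric]) auto
    then show ?thesis using that Ac by (metis M.M.minus_minus)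
  qed
  define p where "p x = (THE a. a \<in> A \<and> (\<exists>b\<in>B. x = a \<oplus>\<^bsub>M\<^esub> b))" for x
  have p: "p (a \<oplus>\<^bsub>M\<^esub> b) = a" if "a \<in> A" "b \<in> B" for a b
    unfolding p_def
  proof (rule the_equality)
    show "a \<in> A \<and> (\<exists>b'\<in>B. a \<oplus>\<^bsub>M\<^esub> b = a \<oplus>\<^bsub>M\<^esub> b')" using that by auto
    fix a' assume "a' \<in> A \<and> (\<exists>b'\<in>B. a \<oplus>\<^bsub>M\<^esub> b = a' \<oplus>\<^bsub>M\<^esub> b')"
    then show "a' = a" using that uniq by metis
  qed
  have "p \<in> left_module_hom R M (M\<lparr>carrier := A\<rparr>)"
    unfolding left_module_hom_def
  proof (intro CollectI conjI ballI)
    show "p \<in> carrier M \<rightarrow> carrier (M\<lparr>carrier := A\<rparr>)" using ex p by fastforce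
  next
    fix x y assume "x \<in> carrier M" "y \<in> carrier M"
    then obtain a b a' b' where ab: "a \<in> A" "b \<in> B" "x = a \<oplus>\<^bsub>M\<^esub> b" "a' \<in> A" "b' \<in> B" "y = a' \<oplus>\<^bsub>M\<^esub> b'"
      using ex by metis
    have "x \<oplus>\<^bsub>M\<^esub> y = (a \<oplus>\<^bsub>M\<^esub> a') \<oplus>\<^bsub>M\<^esub> (b \<oplus>\<^bsub>M\<^esub> b')" using ab Ac Bc by (simp add: M.M.a_ac)
    then show "p (x \<oplus>\<^bsub>M\<^esub> y) = p x \<oplus>\<^bsub>M\<lparr>carrier := A\<rparr>\<^esub> p y" using ab p Aadd Badd by simp
  next
    fix r x assume r: "r \<in> carrier R" and "x \<in> carrier M"
    then obtain a b where ab: "a \<in> A" "b \<in> B" "x = a \<oplus>\<^bsub>M\<^esub> b" using ex by metis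
    then show "p (r \<odot>\<^bsub>M\<^esub> x) = r \<odot>\<^bsub>M\<lparr>carrier := A\<rparr>\<^esub> p x"
      using p r Ac Bc by (simp add: M.smult_r_distr)
  qed
  moreover have "p a = a" if "a \<in> A" for a
    using p[OF that, of "\<zero>\<^bsub>M\<^esub>"] Ac[OF that] int by auto
  ultimately show ?thesis using that by blast
qed

theorem projective_module_lift:
  fixes P :: "('r, 'p, 'j) module_scheme"
  assumes P: "projective_module R P" and M: "left_module R M" and N: "left_module R N"
    and g: "g \<in> left_module_hom R M N" "g ` carrier M = carrier N" and f: "f \<in> left_module_hom R P N"
  shows "\<exists>h \<in> left_module_hom R P M. \<forall>x\<in>carrier P. g (h x) = f x"
proof -
  interpret P: left_module R P using P by (simp add: projective_module_def)
  obtain X :: "'p set" and A \<iota> where A: "direct_summand R A (free_module R X)"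
    and \<iota>: "\<iota> \<in> left_module_hom R P ((free_module R X)\<lparr>carrier := A\<rparr>)" "bij_betw \<iota> (carrier P) A"
    using P unfolding projective_module_def module_isomorphic_def by auto
  let ?F = "free_module R X"
  note F = left_module_free_module[OF P.R.ring_axioms, of X]
  interpret F: left_module R ?F by fact
  obtain p where p: "p \<in> left_module_hom R ?F (?F\<lparr>carrier := A\<rparr>)" "\<And>a. a \<in> A \<Longrightarrow> p a = a"
    using direct_summand_projection[OF F A] by blast
  have Asub: "submodule A R ?F" using A by (simp add: direct_summand_def)
  interpret A: submodule A R ?F by fact
  define \<kappa> where "\<kappa> = inv_into (carrier P) \<iota>"
  have \<kappa>\<iota>: "\<kappa> (\<iota> x) = x" if "x \<in> carrier P" for x
    using that \<iota>(2) by (simp add: \<kappa>_def bij_betw_def)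
  have \<kappa>c: "\<kappa> a \<in> carrier P" "\<iota> (\<kappa> a) = a" if "a \<in> A" for a
    using that \<iota>(2) by (auto simp: \<kappa>_def bij_betw_def inv_into_into f_inv_into_f)
  have \<kappa>: "\<kappa> \<in> left_module_hom R (?F\<lparr>carrier := A\<rparr>) P"
    unfolding left_module_hom_def
  proof (intro CollectI conjI ballI)
    show "\<kappa> \<in> carrier (?F\<lparr>carrier := A\<rparr>) \<rightarrow> carrier P" using \<kappa>c by auto
  next
    fix a b assume "a \<in> carrier (?F\<lparr>carrier := A\<rparr>)" "b \<in> carrier (?F\<lparr>carrier := A\<rparr>)"
    then have "\<iota> (\<kappa> a \<oplus>\<^bsub>P\<^esub> \<kappa> b) = a \<oplus>\<^bsub>?F\<^esub> b" "\<kappa> a \<oplus>\<^bsub>P\<^esub> \<kappa> b \<in> carrier P"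
      using \<kappa>c \<iota>(1) by (auto simp: left_module_hom_def)
    then show "\<kappa> (a \<oplus>\<^bsub>?F\<lparr>carrier := A\<rparr>\<^esub> b) = \<kappa> a \<oplus>\<^bsub>P\<^esub> \<kappa> b" using \<kappa>\<iota> by fastforce
  next
    fix r a assume "r \<in> carrier R" "a \<in> carrier (?F\<lparr>carrier := A\<rparr>)"
    then have "\<iota> (r \<odot>\<^bsub>P\<^esub> \<kappa> a) = r \<odot>\<^bsub>?F\<^esub> a" "r \<odot>\<^bsub>P\<^esub> \<kappa> a \<in> carrier P"
      using \<kappa>c \<iota>(1) by (auto simp: left_module_hom_def)
    then show "\<kappa> (r \<odot>\<^bsub>?F\<lparr>carrier := A\<rparr>\<^esub> a) = r \<odot>\<^bsub>P\<^esub> \<kappa> a" using \<kappa>\<iota> by fastforce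
  qed
  have \<iota>F: "\<iota> \<in> left_module_hom R P ?F"
    using \<iota>(1) A.subset by (auto simp: left_module_hom_def)
  define q where "q v = f (\<kappa> (p v))" for v
  have q: "q \<in> left_module_hom R ?F N"
    unfolding q_def by (intro left_module_hom_compose[OF _ f] left_module_hom_compose[OF p(1) \<kappa>])
  have "\<exists>m. m \<in> carrier M \<and> g m = q (free_basis R x)" if "x \<in> X" for x
  proof -
    have "q (free_basis R x) \<in> g ` carrier M"
      using q g(2) free_basis_closed[OF P.R.ring_axioms that] by (auto simp: left_module_hom_def)
    then show ?thesis by auto
  qed
  then obtain m where m: "\<And>x. x \<in> X \<Longrightarrow> m x \<in> carrier M \<and> g (m x) = q (free_basis R x)" by metis
  obtain k where k: "k \<in> left_module_hom R ?F M" "\<And>x. x \<in> X \<Longrightarrow> k (free_basis R x) = m x"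
    using free_module_universal[OF M, of m X] m by auto
  have gk: "g (k v) = q v" if "v \<in> carrier ?F" for v
    by (rule free_left_module_hom_eq[OF N left_module_hom_compose[OF k(1) g(1)] q _ that]) (simp add: k m)
  show ?thesis
  proof
    show "(\<lambda>x. k (\<iota> x)) \<in> left_module_hom R P M" by (rule left_module_hom_compose[OF \<iota>F k(1)])
    show "\<forall>x\<in>carrier P. g (k (\<iota> x)) = f x"
    proof
      fix x assume x: "x \<in> carrier P"
      then have "\<iota> x \<in> A" using \<iota>(2) by (auto simp: bij_betw_def)
      moreover have "\<iota> x \<in> carrier ?F" using \<iota>F x by (auto simp: left_module_hom_def)
      ultimately show "g (k (\<iota> x)) = f x" using x by (simp add: gk q_def p(2) \<kappa>\<iota>)
    qed
  qed
qed

text \<open>Conversely, lifting along surjections from the free module on the carrier suffices.\<close>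

theorem projective_moduleI:
  fixes P :: "('r, 'p, 'j) module_scheme"
  assumes P: "left_module R P"
    and lift: "\<And>g. g \<in> left_module_hom R (free_module R (carrier P)) P \<Longrightarrow>
        g ` carrier (free_module R (carrier P)) = carrier P \<Longrightarrow>
        \<exists>h \<in> left_module_hom R P (free_module R (carrier P)). \<forall>x\<in>carrier P. g (h x) = x"
  shows "projective_module R P"
proof -
  interpret P: left_module R P by fact
  let ?F = "free_module R (carrier P)"
  note F = left_module_free_module[OF P.R.ring_axioms, of "carrier P"]
  interpret F: left_module R ?F by fact
  obtain g where g: "g \<in> left_module_hom R ?F P" "\<And>x. x \<in> carrier P \<Longrightarrow> g (free_basis R x) = x"
    using free_module_universal[OF P, of "\<lambda>x. x" "carrier P"] by auto
  have "g ` carrier ?F = carrier P"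
  proof
    show "g ` carrier ?F \<subseteq> carrier P" using g(1) by (auto simp: left_module_hom_def)
    show "carrier P \<subseteq> g ` carrier ?F"
      using g(2) free_basis_closed[OF P.R.ring_axioms] by (metis image_eqI subsetI)
  qed
  then obtain h where h: "h \<in> left_module_hom R P ?F" "\<And>x. x \<in> carrier P \<Longrightarrow> g (h x) = x"
    using lift[OF g(1)] by auto
  have hc: "x \<in> carrier P \<Longrightarrow> h x \<in> carrier ?F"
    and hadd: "x \<in> carrier P \<Longrightarrow> y \<in> carrier P \<Longrightarrow> h (x \<oplus>\<^bsub>P\<^esub> y) = h x \<oplus>\<^bsub>?F\<^esub> h y"
    and hsm: "a \<in> carrier R \<Longrightarrow> x \<in> carrier P \<Longrightarrow> h (a \<odot>\<^bsub>P\<^esub> x) = a \<odot>\<^bsub>?F\<^esub> h x" for x y a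
    using h(1) by (auto simp: left_module_hom_def)
  have gc: "v \<in> carrier ?F \<Longrightarrow> g v \<in> carrier P"
    and gadd: "v \<in> carrier ?F \<Longrightarrow> w \<in> carrier ?F \<Longrightarrow> g (v \<oplus>\<^bsub>?F\<^esub> w) = g v \<oplus>\<^bsub>P\<^esub> g w"
    and gsm: "a \<in> carrier R \<Longrightarrow> v \<in> carrier ?F \<Longrightarrow> g (a \<odot>\<^bsub>?F\<^esub> v) = a \<odot>\<^bsub>P\<^esub> g v" for v w a
    using g(1) by (auto simp: left_module_hom_def)
  have h0: "h \<zero>\<^bsub>P\<^esub> = \<zero>\<^bsub>?F\<^esub>" by (rule left_module_hom_zero[OF P F h(1)])
  have g0: "g \<zero>\<^bsub>?F\<^esub> = \<zero>\<^bsub>P\<^esub>" by (rule left_module_hom_zero[OF F P g(1)])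
  have hneg: "h (\<ominus>\<^bsub>P\<^esub> x) = \<ominus>\<^bsub>?F\<^esub> h x" if "x \<in> carrier P" for x
    using that hadd[of "\<ominus>\<^bsub>P\<^esub> x" x] hc h0 by (intro F.M.minus_equality[symmetric]) (auto simp: P.M.l_neg)
  have gneg: "g (\<ominus>\<^bsub>?F\<^esub> v) = \<ominus>\<^bsub>P\<^esub> g v" if "v \<in> carrier ?F" for v
    using that gadd[of "\<ominus>\<^bsub>?F\<^esub> v" v] gc g0 by (intro P.M.minus_equality[symmetric]) (auto simp: F.M.l_neg)
  define A where "A = h ` carrier P"
  define B where "B = {v \<in> carrier ?F. g v = \<zero>\<^bsub>P\<^esub>}"
  have A: "submodule A R ?F"
  proof (intro submodule.intro submodule_axioms.intro)
    show "subgroup A (add_monoid ?F)"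
    proof (rule F.M.add.subgroupI)
      show "A \<subseteq> carrier ?F" "A \<noteq> {}" using hc P.M.zero_closed by (auto simp: A_def)
      fix a assume "a \<in> A"
      then obtain x where x: "x \<in> carrier P" "a = h x" by (auto simp: A_def)
      then show "\<ominus>\<^bsub>?F\<^esub> a \<in> A" using hneg[of x] unfolding A_def by (metis P.M.a_inv_closed imageI)
      fix b assume "b \<in> A"
      then obtain y where y: "y \<in> carrier P" "b = h y" by (auto simp: A_def)
      show "a \<oplus>\<^bsub>?F\<^esub> b \<in> A" using x y hadd[of x y] unfolding A_def by (metis P.M.add.m_closed imageI)
    qed
    fix r a assume r: "r \<in> carrier R" "a \<in> A"
    then obtain x where "x \<in> carrier P" "a = h x" by (auto simp: A_def)
    then show "r \<odot>\<^bsub>?F\<^esub> a \<in> A" using hsm[of r x] r unfolding A_def by (metis P.smult_closed imageI)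
  qed
  have B: "submodule B R ?F"
  proof (intro submodule.intro submodule_axioms.intro)
    show "subgroup B (add_monoid ?F)"
    proof (rule F.M.add.subgroupI)
      show "B \<subseteq> carrier ?F" by (auto simp: B_def)
      show "B \<noteq> {}" using g0 F.M.zero_closed unfolding B_def by blast
      show "\<ominus>\<^bsub>?F\<^esub> a \<in> B" if "a \<in> B" for a using that gneg by (auto simp: B_def)
      show "a \<oplus>\<^bsub>?F\<^esub> b \<in> B" if "a \<in> B" "b \<in> B" for a b using that gadd by (auto simp: B_def)
    qed
    show "r \<odot>\<^bsub>?F\<^esub> a \<in> B" if "r \<in> carrier R" "a \<in> B" for r a using that gsm by (auto simp: B_def)
  qed
  have int: "A \<inter> B = {\<zero>\<^bsub>?F\<^esub>}"
  proof
    show "A \<inter> B \<subseteq> {\<zero>\<^bsub>?F\<^esub>}" using h(2) h0 by (auto simp: A_def B_def)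
    show "{\<zero>\<^bsub>?F\<^esub>} \<subseteq> A \<inter> B"
      using h0 g0 P.M.zero_closed F.M.zero_closed unfolding A_def B_def by (auto intro!: image_eqI[of _ h "\<zero>\<^bsub>P\<^esub>"])
  qed
  have sum: "A <+>\<^bsub>?F\<^esub> B = carrier ?F"
  proof
    show "A <+>\<^bsub>?F\<^esub> B \<subseteq> carrier ?F" using hc by (auto simp: A_def B_def set_add_def set_mult_def)
    show "carrier ?F \<subseteq> A <+>\<^bsub>?F\<^esub> B"
    proof
      fix v assume v: "v \<in> carrier ?F"
      let ?a = "h (g v)" and ?b = "\<ominus>\<^bsub>?F\<^esub> h (g v) \<oplus>\<^bsub>?F\<^esub> v"
      have a: "?a \<in> carrier ?F" "?a \<in> A" using v gc hc by (auto simp: A_def)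
      have "g ?b = \<zero>\<^bsub>P\<^esub>" using v a gadd gneg gc h(2) by (simp add: P.M.l_neg)
      then have "?b \<in> B" using v a by (simp add: B_def)
      moreover have "v = ?a \<oplus>\<^bsub>?F\<^esub> ?b" using v a by (simp add: F.M.r_neg2)
      ultimately show "v \<in> A <+>\<^bsub>?F\<^esub> B" using a(2) unfolding set_add_def set_mult_def by auto
    qed
  qed
  have "h \<in> left_module_hom R P (?F\<lparr>carrier := A\<rparr>)" using h(1) by (auto simp: left_module_hom_def A_def)
  moreover have "bij_betw h (carrier P) A"
    unfolding A_def bij_betw_def using h(2) by (metis inj_onI)
  ultimately have "module_isomorphic R P (?F\<lparr>carrier := A\<rparr>)"
    unfolding module_isomorphic_def by auto
  moreover have "direct_summand R A ?F" unfolding direct_summand_def using A B int sum by blast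
  ultimately show ?thesis unfolding projective_module_def using P by blast
qed

section \<open>The constructions are well defined\<close>

lemma presented_eq_lists:
  assumes "E \<subseteq> lists S \<times> lists S" "presented_eq S E u v"
  shows "u \<in> lists S \<and> v \<in> lists S"
  using assms(2) by induct (use assms(1) in auto)

lemma word_class_eq_iff:
  assumes "u \<in> lists S"
  shows "word_class S E u = word_class S E v \<longleftrightarrow> presented_eq S E u v"
proof
  assume "word_class S E u = word_class S E v"
  moreover have "u \<in> word_class S E u" using assms by (simp add: word_class_def presented_eq.word_refl)
  ultimately show "presented_eq S E u v" by (auto simp: word_class_def intro: presented_eq.word_sym)
qed (auto simp: word_class_def intro: presented_eq.word_trans presented_eq.word_sym)

lemma word_class_mult:
  assumes "u \<in> lists S" "v \<in> lists S"
  shows "word_class S E u \<otimes>\<^bsub>presented_monoid S E\<^esub> word_class S E v = word_class S E (u @ v)"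
proof -
  have eq: "word_class S E (a @ b) = word_class S E (u @ v)"
    if "a \<in> word_class S E u" "b \<in> word_class S E v" for a b
  proof -
    have "presented_eq S E u a" "presented_eq S E v b" using that by (simp_all add: word_class_def)
    then have "presented_eq S E (u @ v) (a @ b)" by (rule presented_eq.word_mult)
    moreover have "u @ v \<in> lists S" using assms by simp
    ultimately show ?thesis using word_class_eq_iff by metis
  qed
  have "u \<in> word_class S E u" "v \<in> word_class S E v"
    using assms by (auto simp: word_class_def intro: presented_eq.word_refl)
  then have "(\<Union>a\<in>word_class S E u. \<Union>b\<in>word_class S E v. word_class S E (a @ b)) = word_class S E (u @ v)"
    using eq by blast
  then show ?thesis by (simp add: presented_monoid_def)
qed

lemma monoid_presented_monoid: "monoid (presented_monoid S E)"
proof -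
  have c: "carrier (presented_monoid S E) = word_class S E ` lists S"
    and o: "\<one>\<^bsub>presented_monoid S E\<^esub> = word_class S E []" by (simp_all add: presented_monoid_def)
  show ?thesis
  proof (rule monoidI)
    fix x y z
    assume "x \<in> carrier (presented_monoid S E)" "y \<in> carrier (presented_monoid S E)"
      "z \<in> carrier (presented_monoid S E)"
    then obtain u v w where "x = word_class S E u" "u \<in> lists S" "y = word_class S E v" "v \<in> lists S"
      "z = word_class S E w" "w \<in> lists S" unfolding c by blast
    then show "x \<otimes>\<^bsub>presented_monoid S E\<^esub> y \<otimes>\<^bsub>presented_monoid S E\<^esub> z
        = x \<otimes>\<^bsub>presented_monoid S E\<^esub> (y \<otimes>\<^bsub>presented_monoid S E\<^esub> z)"
      by (simp only: word_class_mult append_in_lists_conv simp_thms append_assoc)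
  next
    fix x y assume "x \<in> carrier (presented_monoid S E)" "y \<in> carrier (presented_monoid S E)"
    then obtain u v where "x = word_class S E u" "u \<in> lists S" "y = word_class S E v" "v \<in> lists S"
      unfolding c by blast
    then show "x \<otimes>\<^bsub>presented_monoid S E\<^esub> y \<in> carrier (presented_monoid S E)"
      unfolding c by (simp only: word_class_mult) (simp only: imageI append_in_lists_conv simp_thms)
  next
    show "\<one>\<^bsub>presented_monoid S E\<^esub> \<in> carrier (presented_monoid S E)" unfolding c o by blast
  next
    fix x assume "x \<in> carrier (presented_monoid S E)"
    then obtain u where u: "x = word_class S E u" "u \<in> lists S" unfolding c by blast
    have "[] \<in> lists S" by simp
    then show "\<one>\<^bsub>presented_monoid S E\<^esub> \<otimes>\<^bsub>presented_monoid S E\<^esub> x = x"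
      "x \<otimes>\<^bsub>presented_monoid S E\<^esub> \<one>\<^bsub>presented_monoid S E\<^esub> = x"
      unfolding o u(1) by (simp_all only: word_class_mult u(2) append_Nil append_Nil2)
  qed
qed

lemma rook_relations_lists: "rook_relations n \<subseteq> lists {..<n} \<times> lists {..<n}"
  by (auto simp: rook_relations_def)

lemma submonoid_generated_submonoid:
  assumes "monoid M" "S \<subseteq> carrier M"
  shows "submonoid (carrier (generated_submonoid M S)) M"
proof -
  interpret monoid M by fact
  have "submonoid (carrier M) M" by unfold_locales auto
  then show ?thesis
    using assms(2) unfolding generated_submonoid_def
    by (intro submonoid.intro) (auto intro: submonoid.m_closed submonoid.one_closed)
qed

lemma monoid_rook_monoid: "monoid (rook_monoid n)"
  by (simp add: rook_monoid_def monoid_presented_monoid)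

lemma submonoid_hecke_monoid: "submonoid (carrier (hecke_monoid n)) (rook_monoid n)"
  unfolding hecke_monoid_def
  by (rule submonoid_generated_submonoid[OF monoid_rook_monoid])
     (auto simp: rook_gen_def rook_monoid_def presented_monoid_def)

lemma monoid_hecke_monoid: "monoid (hecke_monoid n)"
proof -
  have "hecke_monoid n = (rook_monoid n)\<lparr>carrier := carrier (hecke_monoid n)\<rparr>"
    by (simp add: hecke_monoid_def generated_submonoid_def)
  then show ?thesis
    using submonoid.submonoid_is_monoid[OF submonoid_hecke_monoid monoid_rook_monoid, of n] by simp
qed

lemma monoid_algebra_mult:
  assumes "finite S" "finite T" "{x. f x \<noteq> 0} \<subseteq> S" "{x. g x \<noteq> 0} \<subseteq> T"
  shows "(f \<otimes>\<^bsub>monoid_algebra M\<^esub> g) x = (\<Sum>y\<in>S. \<Sum>z\<in>T. if y \<otimes>\<^bsub>M\<^esub> z = x then f y * g z else 0)"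
proof -
  have "(f \<otimes>\<^bsub>monoid_algebra M\<^esub> g) x
      = (\<Sum>y | f y \<noteq> 0. \<Sum>z | g z \<noteq> 0. if y \<otimes>\<^bsub>M\<^esub> z = x then f y * g z else 0)"
    by (simp add: monoid_algebra_def)
  also have "\<dots> = (\<Sum>y | f y \<noteq> 0. \<Sum>z\<in>T. if y \<otimes>\<^bsub>M\<^esub> z = x then f y * g z else 0)"
    using assms by (intro sum.cong[OF refl] sum.mono_neutral_left) auto
  also have "\<dots> = (\<Sum>y\<in>S. \<Sum>z\<in>T. if y \<otimes>\<^bsub>M\<^esub> z = x then f y * g z else 0)"
  proof (rule sum.mono_neutral_left[OF assms(1,3)], rule ballI)
    fix y assume "y \<in> S - {x. f x \<noteq> 0}"
    then show "(\<Sum>z\<in>T. if y \<otimes>\<^bsub>M\<^esub> z = x then f y * g z else 0) = 0" by (intro sum.neutral) auto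
  qed
  finally show ?thesis .
qed

lemma monoid_algebra_mult_support:
  "{x. (f \<otimes>\<^bsub>monoid_algebra M\<^esub> g) x \<noteq> 0} \<subseteq> (\<lambda>(y, z). y \<otimes>\<^bsub>M\<^esub> z) ` ({x. f x \<noteq> 0} \<times> {x. g x \<noteq> 0})"
proof (rule subsetI, rule ccontr)
  fix x
  assume "x \<in> {x. (f \<otimes>\<^bsub>monoid_algebra M\<^esub> g) x \<noteq> 0}"
    and "x \<notin> (\<lambda>(y, z). y \<otimes>\<^bsub>M\<^esub> z) ` ({x. f x \<noteq> 0} \<times> {x. g x \<noteq> 0})"
  moreover from this(2) have "(f \<otimes>\<^bsub>monoid_algebra M\<^esub> g) x = 0"
    by (auto simp: monoid_algebra_def intro!: sum.neutral)
  ultimately show False by simp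
qed

lemma ring_monoid_algebra:
  assumes "monoid M"
  shows "ring (monoid_algebra M)"
proof -
  interpret monoid M by fact
  let ?A = "monoid_algebra M"
  have fin_add: "finite {x. f x + g x \<noteq> 0}" if "finite {x. f x \<noteq> 0}" "finite {x. g x \<noteq> 0}" for f g :: "'a \<Rightarrow> complex"
    by (rule finite_subset[OF _ finite_UnI[OF that]]) auto
  have fin: "finite {x. f x \<noteq> 0}" "{x. f x \<noteq> 0} \<subseteq> carrier M" if "f \<in> carrier ?A" for f
    using that by (auto simp: monoid_algebra_def)
  have ag: "abelian_group ?A"
  proof (rule abelian_groupI)
    fix f assume "f \<in> carrier ?A"
    then show "\<exists>g\<in>carrier ?A. g \<oplus>\<^bsub>?A\<^esub> f = \<zero>\<^bsub>?A\<^esub>"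
      by (intro bexI[of _ "\<lambda>x. - f x"]) (auto simp: monoid_algebra_def)
  next
    fix f g assume "f \<in> carrier ?A" "g \<in> carrier ?A"
    then show "f \<oplus>\<^bsub>?A\<^esub> g \<in> carrier ?A" using fin_add[of f g] by (auto simp: monoid_algebra_def) force
  qed (auto simp: monoid_algebra_def)
  have mcl: "f \<otimes>\<^bsub>?A\<^esub> g \<in> carrier ?A" if "f \<in> carrier ?A" "g \<in> carrier ?A" for f g
  proof -
    let ?U = "(\<lambda>(y, z). y \<otimes>\<^bsub>M\<^esub> z) ` ({x. f x \<noteq> 0} \<times> {x. g x \<noteq> 0})"
    have "finite ?U" "?U \<subseteq> carrier M" using fin[OF that(1)] fin[OF that(2)] by (auto simp: subset_iff)
    then have "finite {x. (f \<otimes>\<^bsub>?A\<^esub> g) x \<noteq> 0}" "{x. (f \<otimes>\<^bsub>?A\<^esub> g) x \<noteq> 0} \<subseteq> carrier M"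
      using monoid_algebra_mult_support[of M f g] by (blast intro: finite_subset)+
    then show ?thesis unfolding monoid_algebra_def by simp
  qed
  have one: "\<one>\<^bsub>?A\<^esub> = (\<lambda>x. if x = \<one>\<^bsub>M\<^esub> then 1 else 0)" by (simp add: monoid_algebra_def)
  have one1: "\<one>\<^bsub>?A\<^esub> \<one>\<^bsub>M\<^esub> = 1" by (simp add: one)
  have onecl: "\<one>\<^bsub>?A\<^esub> \<in> carrier ?A" by (auto simp: monoid_algebra_def)
  have lone: "\<one>\<^bsub>?A\<^esub> \<otimes>\<^bsub>?A\<^esub> f = f" if f: "f \<in> carrier ?A" for f
  proof
    fix x
    have "(\<one>\<^bsub>?A\<^esub> \<otimes>\<^bsub>?A\<^esub> f) x = (\<Sum>y\<in>{\<one>\<^bsub>M\<^esub>}. \<Sum>z | f z \<noteq> 0. if y \<otimes>\<^bsub>M\<^esub> z = x then \<one>\<^bsub>?A\<^esub> y * f z else 0)"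
      using fin[OF f] by (intro monoid_algebra_mult) (auto simp: one)
    also have "\<dots> = (\<Sum>z | f z \<noteq> 0. if z = x then f z else 0)"
      using fin(2)[OF f]
      by (simp, intro sum.cong refl) (auto simp: subset_iff one1)
    also have "\<dots> = f x" using fin[OF f] by (simp add: sum.delta)
    finally show "(\<one>\<^bsub>?A\<^esub> \<otimes>\<^bsub>?A\<^esub> f) x = f x" .
  qed
  have rone: "f \<otimes>\<^bsub>?A\<^esub> \<one>\<^bsub>?A\<^esub> = f" if f: "f \<in> carrier ?A" for f
  proof
    fix x
    have "(f \<otimes>\<^bsub>?A\<^esub> \<one>\<^bsub>?A\<^esub>) x = (\<Sum>y | f y \<noteq> 0. \<Sum>z\<in>{\<one>\<^bsub>M\<^esub>}. if y \<otimes>\<^bsub>M\<^esub> z = x then f y * \<one>\<^bsub>?A\<^esub> z else 0)"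
      using fin[OF f] by (intro monoid_algebra_mult) (auto simp: one)
    also have "\<dots> = (\<Sum>z | f z \<noteq> 0. if z = x then f z else 0)"
      using fin(2)[OF f]
      by (simp, intro sum.cong refl) (auto simp: subset_iff one1)
    also have "\<dots> = f x" using fin[OF f] by (simp add: sum.delta)
    finally show "(f \<otimes>\<^bsub>?A\<^esub> \<one>\<^bsub>?A\<^esub>) x = f x" .
  qed
  have assoc: "f \<otimes>\<^bsub>?A\<^esub> g \<otimes>\<^bsub>?A\<^esub> h = f \<otimes>\<^bsub>?A\<^esub> (g \<otimes>\<^bsub>?A\<^esub> h)"
    if f: "f \<in> carrier ?A" and g: "g \<in> carrier ?A" and h: "h \<in> carrier ?A" for f g h
  proof
    fix x
    let ?S = "{x. f x \<noteq> 0}" and ?T = "{x. g x \<noteq> 0}" and ?V = "{x. h x \<noteq> 0}"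
    let ?U = "(\<lambda>(y, z). y \<otimes>\<^bsub>M\<^esub> z) ` (?S \<times> ?T)" and ?W = "(\<lambda>(y, z). y \<otimes>\<^bsub>M\<^esub> z) ` (?T \<times> ?V)"
    have fins: "finite ?S" "finite ?T" "finite ?V" "finite ?U" "finite ?W" using fin f g h by auto
    have "(f \<otimes>\<^bsub>?A\<^esub> g \<otimes>\<^bsub>?A\<^esub> h) x = (\<Sum>u\<in>?U. \<Sum>c\<in>?V. if u \<otimes>\<^bsub>M\<^esub> c = x then (f \<otimes>\<^bsub>?A\<^esub> g) u * h c else 0)"
      by (intro monoid_algebra_mult fins monoid_algebra_mult_support order_refl)
    also have "\<dots> = (\<Sum>u\<in>?U. \<Sum>c\<in>?V. \<Sum>a\<in>?S. \<Sum>b\<in>?T.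
        if a \<otimes>\<^bsub>M\<^esub> b = u then if u \<otimes>\<^bsub>M\<^esub> c = x then f a * g b * h c else 0 else 0)"
    proof (intro sum.cong refl)
      fix u c
      show "(if u \<otimes>\<^bsub>M\<^esub> c = x then (f \<otimes>\<^bsub>?A\<^esub> g) u * h c else 0) = (\<Sum>a\<in>?S. \<Sum>b\<in>?T.
          if a \<otimes>\<^bsub>M\<^esub> b = u then if u \<otimes>\<^bsub>M\<^esub> c = x then f a * g b * h c else 0 else 0)"
        unfolding monoid_algebra_mult[OF fins(1,2) order_refl order_refl]
        by (cases "u \<otimes>\<^bsub>M\<^esub> c = x")
          (simp_all add: sum_distrib_right if_distrib[of "\<lambda>t. t * h c"] cong: if_cong)
    qed
    also have "\<dots> = (\<Sum>c\<in>?V. \<Sum>u\<in>?U. \<Sum>a\<in>?S. \<Sum>b\<in>?T.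
        if a \<otimes>\<^bsub>M\<^esub> b = u then if u \<otimes>\<^bsub>M\<^esub> c = x then f a * g b * h c else 0 else 0)"
      by (rule sum.swap)
    also have "\<dots> = (\<Sum>c\<in>?V. \<Sum>a\<in>?S. \<Sum>u\<in>?U. \<Sum>b\<in>?T.
        if a \<otimes>\<^bsub>M\<^esub> b = u then if u \<otimes>\<^bsub>M\<^esub> c = x then f a * g b * h c else 0 else 0)"
      by (intro sum.cong refl sum.swap)
    also have "\<dots> = (\<Sum>c\<in>?V. \<Sum>a\<in>?S. \<Sum>b\<in>?T. \<Sum>u\<in>?U.
        if a \<otimes>\<^bsub>M\<^esub> b = u then if u \<otimes>\<^bsub>M\<^esub> c = x then f a * g b * h c else 0 else 0)"
      by (intro sum.cong refl sum.swap)
    also have "\<dots> = (\<Sum>c\<in>?V. \<Sum>a\<in>?S. \<Sum>b\<in>?T. if a \<otimes>\<^bsub>M\<^esub> b \<otimes>\<^bsub>M\<^esub> c = x then f a * g b * h c else 0)"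
      using fins by (intro sum.cong refl, subst sum.delta') auto
    finally have 1: "(f \<otimes>\<^bsub>?A\<^esub> g \<otimes>\<^bsub>?A\<^esub> h) x = \<dots>" .
    have "(f \<otimes>\<^bsub>?A\<^esub> (g \<otimes>\<^bsub>?A\<^esub> h)) x = (\<Sum>a\<in>?S. \<Sum>u\<in>?W. if a \<otimes>\<^bsub>M\<^esub> u = x then f a * (g \<otimes>\<^bsub>?A\<^esub> h) u else 0)"
      by (intro monoid_algebra_mult fins monoid_algebra_mult_support order_refl)
    also have "\<dots> = (\<Sum>a\<in>?S. \<Sum>u\<in>?W. \<Sum>b\<in>?T. \<Sum>c\<in>?V.
        if b \<otimes>\<^bsub>M\<^esub> c = u then if a \<otimes>\<^bsub>M\<^esub> u = x then f a * g b * h c else 0 else 0)"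
    proof (intro sum.cong refl)
      fix a u
      show "(if a \<otimes>\<^bsub>M\<^esub> u = x then f a * (g \<otimes>\<^bsub>?A\<^esub> h) u else 0) = (\<Sum>b\<in>?T. \<Sum>c\<in>?V.
          if b \<otimes>\<^bsub>M\<^esub> c = u then if a \<otimes>\<^bsub>M\<^esub> u = x then f a * g b * h c else 0 else 0)"
        unfolding monoid_algebra_mult[OF fins(2,3) order_refl order_refl]
        by (cases "a \<otimes>\<^bsub>M\<^esub> u = x")
          (simp_all add: sum_distrib_left mult.assoc if_distrib[of "\<lambda>t. f a * t"] cong: if_cong)
    qed
    also have "\<dots> = (\<Sum>a\<in>?S. \<Sum>b\<in>?T. \<Sum>u\<in>?W. \<Sum>c\<in>?V.
        if b \<otimes>\<^bsub>M\<^esub> c = u then if a \<otimes>\<^bsub>M\<^esub> u = x then f a * g b * h c else 0 else 0)"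
      by (intro sum.cong refl sum.swap)
    also have "\<dots> = (\<Sum>a\<in>?S. \<Sum>b\<in>?T. \<Sum>c\<in>?V. \<Sum>u\<in>?W.
        if b \<otimes>\<^bsub>M\<^esub> c = u then if a \<otimes>\<^bsub>M\<^esub> u = x then f a * g b * h c else 0 else 0)"
      by (intro sum.cong refl sum.swap)
    also have "\<dots> = (\<Sum>a\<in>?S. \<Sum>b\<in>?T. \<Sum>c\<in>?V. if a \<otimes>\<^bsub>M\<^esub> (b \<otimes>\<^bsub>M\<^esub> c) = x then f a * g b * h c else 0)"
      using fins by (intro sum.cong refl, subst sum.delta') auto
    also have "\<dots> = (\<Sum>a\<in>?S. \<Sum>c\<in>?V. \<Sum>b\<in>?T. if a \<otimes>\<^bsub>M\<^esub> (b \<otimes>\<^bsub>M\<^esub> c) = x then f a * g b * h c else 0)"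
      by (intro sum.cong refl sum.swap)
    also have "\<dots> = (\<Sum>c\<in>?V. \<Sum>a\<in>?S. \<Sum>b\<in>?T. if a \<otimes>\<^bsub>M\<^esub> (b \<otimes>\<^bsub>M\<^esub> c) = x then f a * g b * h c else 0)"
      by (rule sum.swap)
    also have "\<dots> = (\<Sum>c\<in>?V. \<Sum>a\<in>?S. \<Sum>b\<in>?T. if a \<otimes>\<^bsub>M\<^esub> b \<otimes>\<^bsub>M\<^esub> c = x then f a * g b * h c else 0)"
    proof (intro sum.cong refl)
      fix c a b assume "c \<in> ?V" "a \<in> ?S" "b \<in> ?T"
      then have "a \<otimes>\<^bsub>M\<^esub> (b \<otimes>\<^bsub>M\<^esub> c) = a \<otimes>\<^bsub>M\<^esub> b \<otimes>\<^bsub>M\<^esub> c" 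
        using fin(2)[OF f] fin(2)[OF g] fin(2)[OF h] by (intro m_assoc[symmetric]) auto
      then show "(if a \<otimes>\<^bsub>M\<^esub> (b \<otimes>\<^bsub>M\<^esub> c) = x then f a * g b * h c else 0)
          = (if a \<otimes>\<^bsub>M\<^esub> b \<otimes>\<^bsub>M\<^esub> c = x then f a * g b * h c else 0)" by simp
    qed
    finally show "(f \<otimes>\<^bsub>?A\<^esub> g \<otimes>\<^bsub>?A\<^esub> h) x = (f \<otimes>\<^bsub>?A\<^esub> (g \<otimes>\<^bsub>?A\<^esub> h)) x" using 1 by simp
  qed
  have add: "(f \<oplus>\<^bsub>?A\<^esub> g) x = f x + g x" for f g x by (simp add: monoid_algebra_def)
  have mon: "monoid ?A" by (rule monoidI) (simp_all add: mcl onecl lone rone assoc)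
  show ?thesis
  proof (intro ring.intro ring_axioms.intro ag mon)
    fix f g h assume f: "f \<in> carrier ?A" and g: "g \<in> carrier ?A" and h: "h \<in> carrier ?A"
    let ?S = "{x. f x \<noteq> 0} \<union> {x. g x \<noteq> 0}" and ?V = "{x. h x \<noteq> 0}"
    have fins: "finite ?S" "finite ?V" using fin f g h by auto
    show "(f \<oplus>\<^bsub>?A\<^esub> g) \<otimes>\<^bsub>?A\<^esub> h = f \<otimes>\<^bsub>?A\<^esub> h \<oplus>\<^bsub>?A\<^esub> g \<otimes>\<^bsub>?A\<^esub> h"
    proof
      fix x
      have "((f \<oplus>\<^bsub>?A\<^esub> g) \<otimes>\<^bsub>?A\<^esub> h) x = (\<Sum>y\<in>?S. \<Sum>z\<in>?V. if y \<otimes>\<^bsub>M\<^esub> z = x then (f y + g y) * h z else 0)"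
        by (subst monoid_algebra_mult[OF fins]) (auto simp: add cong: if_cong)
      also have "\<dots> = (\<Sum>y\<in>?S. \<Sum>z\<in>?V. (if y \<otimes>\<^bsub>M\<^esub> z = x then f y * h z else 0) + (if y \<otimes>\<^bsub>M\<^esub> z = x then g y * h z else 0))"
        by (intro sum.cong refl) (auto simp: algebra_simps)
      also have "\<dots> = (f \<otimes>\<^bsub>?A\<^esub> h) x + (g \<otimes>\<^bsub>?A\<^esub> h) x"
        using monoid_algebra_mult[OF fins, of f h M x] monoid_algebra_mult[OF fins, of g h M x]
        by (auto simp: sum.distrib)
      finally show "((f \<oplus>\<^bsub>?A\<^esub> g) \<otimes>\<^bsub>?A\<^esub> h) x = (f \<otimes>\<^bsub>?A\<^esub> h \<oplus>\<^bsub>?A\<^esub> g \<otimes>\<^bsub>?A\<^esub> h) x" by (simp add: add)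
    qed
    show "h \<otimes>\<^bsub>?A\<^esub> (f \<oplus>\<^bsub>?A\<^esub> g) = h \<otimes>\<^bsub>?A\<^esub> f \<oplus>\<^bsub>?A\<^esub> h \<otimes>\<^bsub>?A\<^esub> g"
    proof
      fix x
      have "(h \<otimes>\<^bsub>?A\<^esub> (f \<oplus>\<^bsub>?A\<^esub> g)) x = (\<Sum>y\<in>?V. \<Sum>z\<in>?S. if y \<otimes>\<^bsub>M\<^esub> z = x then h y * (f z + g z) else 0)"
        by (subst monoid_algebra_mult[OF fins(2,1)]) (auto simp: add cong: if_cong)
      also have "\<dots> = (\<Sum>y\<in>?V. \<Sum>z\<in>?S. (if y \<otimes>\<^bsub>M\<^esub> z = x then h y * f z else 0) + (if y \<otimes>\<^bsub>M\<^esub> z = x then h y * g z else 0))"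
        by (intro sum.cong refl) (auto simp: algebra_simps)
      also have "\<dots> = (h \<otimes>\<^bsub>?A\<^esub> f) x + (h \<otimes>\<^bsub>?A\<^esub> g) x"
        using monoid_algebra_mult[OF fins(2,1), of h f M x] monoid_algebra_mult[OF fins(2,1), of h g M x]
        by (auto simp: sum.distrib)
      finally show "(h \<otimes>\<^bsub>?A\<^esub> (f \<oplus>\<^bsub>?A\<^esub> g)) x = (h \<otimes>\<^bsub>?A\<^esub> f \<oplus>\<^bsub>?A\<^esub> h \<otimes>\<^bsub>?A\<^esub> g) x" by (simp add: add)
    qed
  qed
qed

lemma hecke_algebra_sub:
  "carrier (hecke_algebra n) \<subseteq> carrier (rook_algebra n)"
  "mult (hecke_algebra n) = mult (rook_algebra n)" "one (hecke_algebra n) = one (rook_algebra n)"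
  "zero (hecke_algebra n) = zero (rook_algebra n)" "add (hecke_algebra n) = add (rook_algebra n)"
  using submonoid.subset[OF submonoid_hecke_monoid, of n]
  by (auto simp: monoid_algebra_def hecke_monoid_def generated_submonoid_def)

lemma left_module_restrict:
  assumes "left_module (rook_algebra n) P"
  shows "left_module (hecke_algebra n) P"
proof -
  interpret P: left_module "rook_algebra n" P by fact
  show ?thesis
    using hecke_algebra_sub(1)[of n]
    by (intro left_module.intro left_module_axioms.intro ring_monoid_algebra monoid_hecke_monoid P.M.abelian_group_axioms)
      (auto simp: hecke_algebra_sub(2-) P.smult_l_distr P.smult_r_distr P.smult_assoc1 subset_iff)
qed

lemma left_module_regular_module:
  assumes "ring R" shows "left_module R (regular_module R)"
proof -
  interpret ring R by fact
  have "abelian_group (regular_module R)"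
    by (rule abelian_groupI) (auto simp: regular_module_def a_ac intro: l_neg)
  then show ?thesis
    by (intro left_module.intro left_module_axioms.intro assms)
      (auto simp: regular_module_def l_distr r_distr m_assoc)
qed

end

theory Submission
  imports Defs
begin

text \<open>
  Every element of the rook monoid \<open>R\<close> factors as \<open>x = a x \<otimes> t x\<close>, where \<open>a\<close> maps into the Hecke monoid
  \<open>H\<close> and commutes with left multiplication by \<open>H\<close>, and \<open>t\<close> is invariant under it. Hence
  \<open>x \<mapsto> a x \<cdot> e (t x)\<close> embeds \<open>\<complex>R\<close> as an \<open>H\<close>-module retract of the free module with basis
  \<open>e (t x)\<close>, and retracts of free \<open>\<complex>R\<close>-modules become retracts of free \<open>\<complex>H\<close>-modules.

  The factorisation is read off from the action on rook vectors, where \<open>\<pi>\<^sub>0\<close> replaces the first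
  entry by \<open>0\<close> and \<open>\<pi>\<^sub>i\<close> exchanges the entries \<open>i\<close> and \<open>i + 1\<close> if they are increasing. If \<open>v\<close> is the
  image of \<open>(1, \<dots>, n)\<close> under \<open>x\<close>, then \<open>a x\<close> is the permutation obtained by standardising \<open>v\<close> with its
  zeros numbered decreasingly, and \<open>t x\<close> is the shortest element that kills the letters missing
  from \<open>v\<close>. Because of this numbering of the zeros, \<open>a\<close> is equivariant: \<open>\<pi>\<^sub>i\<close> fixes two adjacent zeros.
\<close>

section \<open>Projective modules as retracts of free modules\<close>

lemma left_module_homD:
  assumes "h \<in> left_module_hom R M N"
  shows "x \<in> carrier M \<Longrightarrow> h x \<in> carrier N"
    and "x \<in> carrier M \<Longrightarrow> y \<in> carrier M \<Longrightarrow> h (x \<oplus>\<^bsub>M\<^esub> y) = h x \<oplus>\<^bsub>N\<^esub> h y"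
    and "a \<in> carrier R \<Longrightarrow> x \<in> carrier M \<Longrightarrow> h (a \<odot>\<^bsub>M\<^esub> x) = a \<odot>\<^bsub>N\<^esub> h x"
  using assms by (auto simp: left_module_hom_def)

text \<open>The basis \<open>X\<close> may live in any type, whereas
  \<open>projective_module\<close> takes it in the type of the elements of \<open>P\<close>. A lift
  of \<open>q\<close> through a surjection \<open>g\<close> is chosen freely on basis vectors;
  composing it with \<open>i\<close> splits \<open>g\<close>.\<close>

lemma projective_module_retract_free:
  assumes P: "left_module R P"
    and i: "i \<in> left_module_hom R P (free_module R X)" and q: "q \<in> left_module_hom R (free_module R X) P"
    and qi: "\<And>x. x \<in> carrier P \<Longrightarrow> q (i x) = x"
  shows "projective_module R P"
proof (rule projective_moduleI[OF P])
  let ?F = "free_module R (carrier P)"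
  interpret P: left_module R P by fact
  fix g assume g: "g \<in> left_module_hom R ?F P" "g ` carrier ?F = carrier P"
  have "\<exists>y. y \<in> carrier ?F \<and> g y = q (free_basis R x)" if "x \<in> X" for x
  proof -
    have "q (free_basis R x) \<in> g ` carrier ?F"
      unfolding g(2) by (intro left_module_homD(1)[OF q] free_basis_closed P.R.ring_axioms that)
    then show ?thesis by auto
  qed
  then obtain m where m: "\<And>x. x \<in> X \<Longrightarrow> m x \<in> carrier ?F \<and> g (m x) = q (free_basis R x)" by metis
  obtain k where k: "k \<in> left_module_hom R (free_module R X) ?F" "\<And>x. x \<in> X \<Longrightarrow> k (free_basis R x) = m x"
    using free_module_universal[OF left_module_free_module[OF P.R.ring_axioms], of m X "carrier P"] m by auto
  have gk: "g (k v) = q v" if "v \<in> carrier (free_module R X)" for v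
    by (rule free_left_module_hom_eq[OF P left_module_hom_compose[OF k(1) g(1)] q _ that]) (simp add: k m)
  show "\<exists>h\<in>left_module_hom R P ?F. \<forall>x\<in>carrier P. g (h x) = x"
    by (intro bexI[OF _ left_module_hom_compose[OF i k(1)]]) (simp add: gk qi left_module_homD(1)[OF i])
qed

text \<open>The canonical map from the free module on the carrier onto \<open>P\<close> splits: lift
  the identity of \<open>P\<close> along it.\<close>

lemma projective_module_free_retract:
  assumes "projective_module R P"
  obtains i q where "i \<in> left_module_hom R P (free_module R (carrier P))"
    "q \<in> left_module_hom R (free_module R (carrier P)) P" "\<And>x. x \<in> carrier P \<Longrightarrow> q (i x) = x"
proof -
  have P: "left_module R P" using assms by (simp add: projective_module_def)
  interpret P: left_module R P by fact
  let ?F = "free_module R (carrier P)"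
  obtain g where g: "g \<in> left_module_hom R ?F P" "\<And>x. x \<in> carrier P \<Longrightarrow> g (free_basis R x) = x"
    using free_module_universal[OF P, of "\<lambda>x. x" "carrier P"] by auto
  have surj: "g ` carrier ?F = carrier P"
  proof
    show "g ` carrier ?F \<subseteq> carrier P" using left_module_homD(1)[OF g(1)] by auto
    show "carrier P \<subseteq> g ` carrier ?F" using g(2) free_basis_closed[OF P.R.ring_axioms] by (metis image_eqI subsetI)
  qed
  have "(\<lambda>x. x) \<in> left_module_hom R P P" by (auto simp: left_module_hom_def)
  then obtain h where "h \<in> left_module_hom R P ?F" "\<And>x. x \<in> carrier P \<Longrightarrow> g (h x) = x"
    using projective_module_lift[OF assms left_module_free_module[OF P.R.ring_axioms] P g(1) surj, of "\<lambda>x. x"] by auto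
  then show ?thesis using that g(1) by blast
qed

lemma projective_regular_module:
  assumes "ring R" shows "projective_module R (regular_module R)"
proof (rule projective_module_retract_free)
  interpret ring R by fact
  \<comment> \<open>The regular module is free of rank one, so the retraction is an
    isomorphism.\<close>
  let ?F = "free_module R {()}"
  show "left_module R (regular_module R)" by (rule left_module_regular_module[OF assms])
  show "(\<lambda>f _. f) \<in> left_module_hom R (regular_module R) ?F"
    by (auto simp: left_module_hom_def regular_module_def free_module_def)
  show "(\<lambda>v. v ()) \<in> left_module_hom R ?F (regular_module R)"
    by (auto simp: left_module_hom_def regular_module_def free_module_def)
qed simp

section \<open>Restriction of projective modules to a submonoid\<close>

definition monomial :: "'m \<Rightarrow> complex \<Rightarrow> 'm \<Rightarrow> complex" where
  "monomial x c = (\<lambda>y. if y = x then c else 0)"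

text \<open>The vector \<open>c z e_x\<close>, where \<open>e_x\<close> is the basis vector at
  \<open>x\<close>. Identities between additive maps out of the free module need checking only on
  these.\<close>

definition free_monomial :: "'x \<Rightarrow> 'm \<Rightarrow> complex \<Rightarrow> 'x \<Rightarrow> 'm \<Rightarrow> complex" where
  "free_monomial x z c = (\<lambda>y. if y = x then monomial z c else (\<lambda>_. 0))"

lemma monoid_algebra_simps:
  "carrier (monoid_algebra M) = {f. {x. f x \<noteq> 0} \<subseteq> carrier M \<and> finite {x. f x \<noteq> 0}}"
  "zero (monoid_algebra M) = (\<lambda>_. 0)" "add (monoid_algebra M) = (\<lambda>f g x. f x + g x)"
  by (simp_all add: monoid_algebra_def)

lemma monomial_closed: "x \<in> carrier M \<Longrightarrow> monomial x c \<in> carrier (monoid_algebra M)"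
  by (auto simp: monoid_algebra_simps monomial_def)

lemma monomial_mult: "monomial x c \<otimes>\<^bsub>monoid_algebra M\<^esub> monomial y d = monomial (x \<otimes>\<^bsub>M\<^esub> y) (c * d)"
  by (rule ext, subst monoid_algebra_mult[of "{x}" "{y}"]) (auto simp: monomial_def)

lemma monomial_mult_free_monomial:
  assumes "monoid M" "y \<in> carrier M"
  shows "monomial y d \<odot>\<^bsub>free_module (monoid_algebra M) X\<^esub> free_monomial x z c = free_monomial x (y \<otimes>\<^bsub>M\<^esub> z) (d * c)"
  \<comment> \<open>Off the coordinate \<open>x\<close> the product is \<open>monomial y d\<close>
    times zero, which the numbered ring rule evaluates.\<close>
  using ring.ring_simprules(25)[OF ring_monoid_algebra[OF assms(1)] monomial_closed[OF assms(2), of d]]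
  by (auto simp: free_module_def free_monomial_def monomial_mult fun_eq_iff monoid_algebra_simps)

lemma free_monomial_closed:
  "x \<in> X \<Longrightarrow> z \<in> carrier M \<Longrightarrow> free_monomial x z c \<in> carrier (free_module (monoid_algebra M) X)"
  using monomial_closed[of z M c] by (auto simp: free_module_def free_monomial_def monoid_algebra_simps)

lemma free_monomial_eq_smult_basis:
  assumes "monoid M" "z \<in> carrier M"
  shows "free_monomial x z c = monomial z c \<odot>\<^bsub>free_module (monoid_algebra M) X\<^esub> free_basis (monoid_algebra M) x"
proof -
  interpret A: ring "monoid_algebra M" by (rule ring_monoid_algebra[OF assms(1)])
  show ?thesis
    using monomial_closed[OF assms(2), of c]
    by (auto simp: free_module_def free_monomial_def free_basis_def fun_eq_iff monoid_algebra_simps(2)[symmetric])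
       (simp add: monoid_algebra_simps(2))
qed

lemma monoid_algebra_induct [consumes 1, case_names zero add]:
  assumes "f \<in> carrier (monoid_algebra M)" and zero: "P (\<lambda>_. 0)"
    and add: "\<And>f y d. f \<in> carrier (monoid_algebra M) \<Longrightarrow> P f \<Longrightarrow> y \<in> carrier M \<Longrightarrow>
      P (f \<oplus>\<^bsub>monoid_algebra M\<^esub> monomial y d)"
  shows "P f"
  using assms(1)
proof (induct "card {x. f x \<noteq> 0}" arbitrary: f)
  case 0
  then have "f = (\<lambda>_. 0)" by (auto simp: monoid_algebra_simps)
  then show ?case using zero by simp
next
  case (Suc n)
  then obtain y where y: "f y \<noteq> 0" by (metis (mono_tags, lifting) card.empty empty_Collect_eq nat.distinct(1))
  let ?f = "f(y := 0)"
  have s: "{x. ?f x \<noteq> 0} = {x. f x \<noteq> 0} - {y}" by auto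
  have "?f \<in> carrier (monoid_algebra M)" using Suc(3) unfolding monoid_algebra_simps mem_Collect_eq s by auto
  moreover have "n = card {x. ?f x \<noteq> 0}" unfolding s using Suc(2,3) y by (simp add: monoid_algebra_simps)
  ultimately have "P (?f \<oplus>\<^bsub>monoid_algebra M\<^esub> monomial y (f y))"
    using Suc(3) y by (intro add Suc(1)) (auto simp: monoid_algebra_simps)
  also have "?f \<oplus>\<^bsub>monoid_algebra M\<^esub> monomial y (f y) = f" by (auto simp: monoid_algebra_simps monomial_def)
  finally show ?case .
qed

text \<open>Induction on the number of pairs \<open>(x, z)\<close> with nonzero coefficient:
  clearing one coefficient removes one \<open>free_monomial\<close>.\<close>

lemma free_module_monoid_algebra_induct [consumes 1, case_names zero add]:
  assumes "v \<in> carrier (free_module (monoid_algebra M) X)" and zero: "P (\<lambda>_ _. 0)"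
    and add: "\<And>v x z c. v \<in> carrier (free_module (monoid_algebra M) X) \<Longrightarrow> P v \<Longrightarrow> x \<in> X \<Longrightarrow> z \<in> carrier M \<Longrightarrow>
      P (v \<oplus>\<^bsub>free_module (monoid_algebra M) X\<^esub> free_monomial x z c)"
  shows "P v"
proof -
  let ?A = "monoid_algebra M"
  let ?F = "free_module ?A X"
  \<comment> \<open>Finitely many nonzero coordinates, each of finite support, amount to one finite
    joint support; its cardinality is the induction measure.\<close>
  have carrierF: "w \<in> carrier ?F \<longleftrightarrow> {(x, z). w x z \<noteq> 0} \<subseteq> X \<times> carrier M \<and> finite {(x, z). w x z \<noteq> 0}" for w
  proof
    assume w: "w \<in> carrier ?F"
    then have "{(x, z). w x z \<noteq> 0} \<subseteq> (\<Union>x\<in>{x. w x \<noteq> (\<lambda>_. 0)}. {x} \<times> {z. w x z \<noteq> 0})" by (auto simp: fun_eq_iff)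
    moreover have "finite (\<Union>x\<in>{x. w x \<noteq> (\<lambda>_. 0)}. {x} \<times> {z. w x z \<noteq> 0})"
    proof (intro finite_UN_I finite_cartesian_product)
      fix x assume "x \<in> {x. w x \<noteq> (\<lambda>_. 0)}"
      then have "x \<in> X" using w by (auto simp: free_module_def monoid_algebra_simps)
      then show "finite {z. w x z \<noteq> 0}" using w by (auto simp: free_module_def monoid_algebra_simps)
    qed (use w in \<open>auto simp: free_module_def monoid_algebra_simps\<close>)
    moreover have "{(x, z). w x z \<noteq> 0} \<subseteq> X \<times> carrier M"
      using w by (auto simp: free_module_def monoid_algebra_simps)
    ultimately show "{(x, z). w x z \<noteq> 0} \<subseteq> X \<times> carrier M \<and> finite {(x, z). w x z \<noteq> 0}"
      by (blast intro: finite_subset)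
  next
    assume w: "{(x, z). w x z \<noteq> 0} \<subseteq> X \<times> carrier M \<and> finite {(x, z). w x z \<noteq> 0}"
    have s: "{x. w x \<noteq> (\<lambda>_. 0)} \<subseteq> fst ` {(x, z). w x z \<noteq> 0}" "{z. w x z \<noteq> 0} \<subseteq> snd ` {(x, z). w x z \<noteq> 0}" for x
      by (force simp: fun_eq_iff)+
    have "finite {x. w x \<noteq> (\<lambda>_. 0)}" "finite {z. w x z \<noteq> 0}" for x
      by (rule finite_subset[OF s(1)] finite_subset[OF s(2)], use w in simp)+
    then show "w \<in> carrier ?F" using w by (auto simp: free_module_def monoid_algebra_simps fun_eq_iff)
  qed
  show ?thesis using assms(1)
  proof (induct "card {(x, z). v x z \<noteq> 0}" arbitrary: v)
    case 0
    then have "v = (\<lambda>_ _. 0)" by (auto simp: carrierF fun_eq_iff)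
    then show ?case using zero by simp
  next
    case (Suc n)
    then have "{(x, z). v x z \<noteq> 0} \<noteq> {}" by (metis card.empty nat.distinct(1))
    then obtain x z where xz: "v x z \<noteq> 0" by auto
    let ?v = "v(x := (v x)(z := 0))"
    have s: "{(x, z). ?v x z \<noteq> 0} = {(x, z). v x z \<noteq> 0} - {(x, z)}" by (auto split: if_splits)
    have "?v \<in> carrier ?F" using Suc(3) unfolding carrierF s by auto
    moreover have "n = card {(x, z). ?v x z \<noteq> 0}" unfolding s using Suc(2,3) xz by (simp add: carrierF)
    ultimately have "P (?v \<oplus>\<^bsub>?F\<^esub> free_monomial x z (v x z))"
      using Suc(3) xz by (intro add Suc(1)) (auto simp: carrierF)
    also have "?v \<oplus>\<^bsub>?F\<^esub> free_monomial x z (v x z) = v"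
      by (intro ext) (auto simp: free_module_def monoid_algebra_simps free_monomial_def monomial_def)
    finally show ?case .
  qed
qed

section \<open>Restriction of scalars along an equivariant factorisation\<close>

lemma left_module_restrict_submonoid:
  assumes "monoid M" "submonoid H M" "left_module (monoid_algebra M) P"
  shows "left_module (monoid_algebra (M\<lparr>carrier := H\<rparr>)) P"
proof -
  interpret P: left_module "monoid_algebra M" P by fact
  have sub: "carrier (monoid_algebra (M\<lparr>carrier := H\<rparr>)) \<subseteq> carrier (monoid_algebra M)"
    using submonoid.subset[OF assms(2)] by (auto simp: monoid_algebra_simps)
  have ops: "mult (monoid_algebra (M\<lparr>carrier := H\<rparr>)) = mult (monoid_algebra M)"
    "one (monoid_algebra (M\<lparr>carrier := H\<rparr>)) = one (monoid_algebra M)"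
    "add (monoid_algebra (M\<lparr>carrier := H\<rparr>)) = add (monoid_algebra M)"
    by (simp_all add: monoid_algebra_def)
  show ?thesis
    using sub
    by (intro left_module.intro left_module_axioms.intro ring_monoid_algebra
        submonoid.submonoid_is_monoid[OF assms(2,1)] P.M.abelian_group_axioms)
      (auto simp: ops P.smult_l_distr P.smult_r_distr P.smult_assoc1 subset_iff)
qed

text \<open>Write \<open>P\<close> as a retract of a free module over the large algebra by
  \<open>i\<close> and \<open>q\<close>. The map \<open>J\<close> takes \<open>z e_x\<close> to
  \<open>a z e_(x, t z)\<close> and is linear over the small algebra by equivariance of
  \<open>a\<close> and invariance of \<open>t\<close>. The map \<open>Q\<close> takes
  \<open>e_(x, \<tau>)\<close> to \<open>\<tau> q(e_x)\<close>, and \<open>a z\<close> times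
  \<open>t z\<close> being \<open>z\<close> gives \<open>Q (J v) = q v\<close>. So \<open>J\<close>
  after \<open>i\<close>, followed by \<open>Q\<close>, is the identity of \<open>P\<close>.\<close>

lemma projective_module_restrict_submonoid:
  fixes P :: "('m \<Rightarrow> complex, 'p, 'j) module_scheme"
  assumes M: "monoid M" and H: "submonoid H M"
    and a_closed: "\<And>x. x \<in> carrier M \<Longrightarrow> a x \<in> H"
    and t_closed: "\<And>x. x \<in> carrier M \<Longrightarrow> t x \<in> carrier M"
    and at: "\<And>x. x \<in> carrier M \<Longrightarrow> a x \<otimes>\<^bsub>M\<^esub> t x = x"
    and a_mult: "\<And>h x. h \<in> H \<Longrightarrow> x \<in> carrier M \<Longrightarrow> a (h \<otimes>\<^bsub>M\<^esub> x) = h \<otimes>\<^bsub>M\<^esub> a x"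
    and t_mult: "\<And>h x. h \<in> H \<Longrightarrow> x \<in> carrier M \<Longrightarrow> t (h \<otimes>\<^bsub>M\<^esub> x) = t x"
    and P: "projective_module (monoid_algebra M) P"
  shows "projective_module (monoid_algebra (M\<lparr>carrier := H\<rparr>)) P"
proof -
  let ?A = "monoid_algebra M" and ?N = "M\<lparr>carrier := H\<rparr>"
  let ?B = "monoid_algebra ?N"
  let ?X = "carrier P" and ?T = "t ` carrier M"
  let ?F = "free_module ?A ?X" and ?G = "free_module ?B (?X \<times> ?T)"
  interpret M: monoid M by fact
  have HM: "h \<in> H \<Longrightarrow> h \<in> carrier M" for h using submonoid.subset[OF H] by auto
  have N: "monoid ?N" by (rule submonoid.submonoid_is_monoid[OF H M])
  have PA: "left_module ?A P" using P by (simp add: projective_module_def)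
  have PB: "left_module ?B P" by (rule left_module_restrict_submonoid[OF M H PA])
  have FA: "left_module ?A ?F" by (rule left_module_free_module[OF ring_monoid_algebra[OF M]])
  have FB: "left_module ?B ?F" by (rule left_module_restrict_submonoid[OF M H FA])
  have GB: "left_module ?B ?G" by (rule left_module_free_module[OF ring_monoid_algebra[OF N]])
  interpret PA: left_module ?A P by fact
  interpret PB: left_module ?B P by fact
  interpret FB: left_module ?B ?F by fact
  interpret GB: left_module ?B ?G by fact
  have sub: "f \<in> carrier ?A" if "f \<in> carrier ?B" for f
    using that HM by (auto simp: monoid_algebra_simps)
  have restrict: "f \<in> left_module_hom ?B Q S" if "f \<in> left_module_hom ?A Q S" for f and Q S :: "('m \<Rightarrow> complex, _, _) module_scheme"
    using that sub by (auto simp: left_module_hom_def)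
  obtain i q where i: "i \<in> left_module_hom ?A P ?F" and q: "q \<in> left_module_hom ?A ?F P"
    and qi: "\<And>x. x \<in> carrier P \<Longrightarrow> q (i x) = x"
    using projective_module_free_retract[OF P] by blast
  have zeros: "\<zero>\<^bsub>?F\<^esub> = (\<lambda>_ _. 0)" "\<zero>\<^bsub>?G\<^esub> = (\<lambda>_ _. 0)" by (simp_all add: free_module_def monoid_algebra_simps)
  have add_apply: "(v \<oplus>\<^bsub>?F\<^esub> w) x z = v x z + w x z" "(v' \<oplus>\<^bsub>?G\<^esub> w') y z = v' y z + w' y z" for v w x z v' w' y
    by (simp_all add: free_module_def monoid_algebra_simps)
  have fin: "finite {z. v x z \<noteq> 0}" "v x z \<noteq> 0 \<Longrightarrow> x \<in> ?X \<and> z \<in> carrier M" if "v \<in> carrier ?F" for v x z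
    using that by (cases "x \<in> ?X"; auto simp: free_module_def monoid_algebra_simps)+
  \<comment> \<open>The coefficient of \<open>h\<close> at the basis vector
    \<open>(x, \<tau>)\<close> collects the \<open>z\<close> with \<open>t z = \<tau>\<close> and
    \<open>a z = h\<close>. Written as a sum, \<open>J\<close> is visibly additive.\<close>
  define J where "J v = (\<lambda>(x, \<tau>) h. \<Sum>z | v x z \<noteq> 0. if t z = \<tau> \<and> a z = h then v x z else 0)" for v :: "'p \<Rightarrow> 'm \<Rightarrow> complex"
  have J: "J v (x, \<tau>) h = (\<Sum>z\<in>S. if t z = \<tau> \<and> a z = h then v x z else 0)"
    if "finite S" "{z. v x z \<noteq> 0} \<subseteq> S" for v x \<tau> h S
    unfolding J_def prod.case using that by (intro sum.mono_neutral_left) auto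
  have J_nz: "\<exists>z. v x z \<noteq> 0 \<and> t z = \<tau> \<and> a z = h" if "J v (x, \<tau>) h \<noteq> 0" for v x \<tau> h
  proof -
    from that obtain z where "v x z \<noteq> 0" "(if t z = \<tau> \<and> a z = h then v x z else 0) \<noteq> 0"
      unfolding J_def prod.case by (rule sum.not_neutral_contains_not_neutral) auto
    then show ?thesis by (auto split: if_splits)
  qed
  have J_closed: "J v \<in> carrier ?G" if v: "v \<in> carrier ?F" for v
  proof -
    have "J v (x, \<tau>) \<in> carrier ?B" for x \<tau>
    proof -
      have "{h. J v (x, \<tau>) h \<noteq> 0} \<subseteq> a ` {z. v x z \<noteq> 0}" using J_nz by blast
      moreover have "a ` {z. v x z \<noteq> 0} \<subseteq> H" using fin(2)[OF v] a_closed by auto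
      ultimately show ?thesis
        using fin(1)[OF v, of x] by (auto simp: monoid_algebra_simps intro: finite_subset)
    qed
    moreover have "J v (x, \<tau>) = (\<lambda>_. 0)" if "(x, \<tau>) \<notin> ?X \<times> ?T" for x \<tau>
      by (rule ext, rule ccontr) (use that J_nz[of v x \<tau>] fin(2)[OF v] in blast)
    moreover have "finite {y. J v y \<noteq> (\<lambda>_. 0)}"
    proof (rule finite_subset)
      show "{y. J v y \<noteq> (\<lambda>_. 0)} \<subseteq> (\<Union>x\<in>{x. v x \<noteq> (\<lambda>_. 0)}. {x} \<times> t ` {z. v x z \<noteq> 0})"
      proof
        fix y assume "y \<in> {y. J v y \<noteq> (\<lambda>_. 0)}"
        then obtain x \<tau> h where "y = (x, \<tau>)" "J v (x, \<tau>) h \<noteq> 0" by (cases y) (auto simp: fun_eq_iff)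
        moreover from this J_nz obtain z where "v x z \<noteq> 0" "t z = \<tau>" by blast
        moreover from this have "v x \<noteq> (\<lambda>_. 0)" by auto
        ultimately show "y \<in> (\<Union>x\<in>{x. v x \<noteq> (\<lambda>_. 0)}. {x} \<times> t ` {z. v x z \<noteq> 0})" by blast
      qed
      show "finite \<dots>"
        using v fin(1)[OF v] by (auto simp: free_module_def monoid_algebra_simps)
    qed
    ultimately show ?thesis by (auto simp: free_module_def monoid_algebra_simps(2))
  qed
  have J_zero: "J (\<lambda>_ _. 0) = (\<lambda>_ _. 0)" by (auto simp: J_def fun_eq_iff)
  have J_add: "J (v \<oplus>\<^bsub>?F\<^esub> w) = J v \<oplus>\<^bsub>?G\<^esub> J w" if v: "v \<in> carrier ?F" and w: "w \<in> carrier ?F" for v w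
  proof (intro ext)
    fix y :: "'p \<times> 'm" and h :: 'm
    obtain x \<tau> where y: "y = (x, \<tau>)" by (cases y)
    let ?S = "{z. v x z \<noteq> 0} \<union> {z. w x z \<noteq> 0}"
    have S: "finite ?S" using fin(1)[OF v] fin(1)[OF w] by auto
    have "J (v \<oplus>\<^bsub>?F\<^esub> w) y h = (\<Sum>z\<in>?S. if t z = \<tau> \<and> a z = h then (v \<oplus>\<^bsub>?F\<^esub> w) x z else 0)"
      unfolding y by (rule J[OF S]) (auto simp: add_apply)
    also have "\<dots> = J v y h + J w y h"
      unfolding y using J[OF S, of v x \<tau> h] J[OF S, of w x \<tau> h]
      by (simp add: sum.distrib[symmetric]) (rule sum.cong, auto simp: add_apply)
    finally show "J (v \<oplus>\<^bsub>?F\<^esub> w) y h = (J v \<oplus>\<^bsub>?G\<^esub> J w) y h" by (simp add: add_apply)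
  qed
  have J_mono: "J (free_monomial x z c) = free_monomial (x, t z) (a z) c" for x z c
  proof (intro ext)
    fix y :: "'p \<times> 'm" and h :: 'm
    obtain x' \<tau> where y: "y = (x', \<tau>)" by (cases y)
    have "J (free_monomial x z c) y h = (\<Sum>u\<in>{z}. if t u = \<tau> \<and> a u = h then free_monomial x z c x' u else 0)"
      unfolding y by (rule J) (auto simp: free_monomial_def monomial_def)
    then show "J (free_monomial x z c) y h = free_monomial (x, t z) (a z) c y h"
      by (auto simp: y free_monomial_def monomial_def)
  qed
  have mono_F: "monomial y d \<odot>\<^bsub>?F\<^esub> free_monomial x z c = free_monomial x (y \<otimes>\<^bsub>M\<^esub> z) (d * c)" if "y \<in> H" for y d x z c
    using monomial_mult_free_monomial[OF M HM[OF that]] .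
  have mono_G: "monomial y d \<odot>\<^bsub>?G\<^esub> free_monomial x z c = free_monomial x (y \<otimes>\<^bsub>M\<^esub> z) (d * c)" if "y \<in> H" for y d x z c
    using monomial_mult_free_monomial[OF N] that by simp
  have mono_B: "monomial y d \<in> carrier ?B" if "y \<in> H" for y d
    using monomial_closed[of y ?N d] that by simp
  have J_smult1: "J (monomial y d \<odot>\<^bsub>?F\<^esub> v) = monomial y d \<odot>\<^bsub>?G\<^esub> J v" if y: "y \<in> H" and v: "v \<in> carrier ?F" for y d v
    using v
  proof (induct v rule: free_module_monoid_algebra_induct)
    case zero
    have "monomial y d \<odot>\<^bsub>?F\<^esub> \<zero>\<^bsub>?F\<^esub> = \<zero>\<^bsub>?F\<^esub>" "monomial y d \<odot>\<^bsub>?G\<^esub> \<zero>\<^bsub>?G\<^esub> = \<zero>\<^bsub>?G\<^esub>"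
      using FB.smult_r_null[OF mono_B[OF y]] GB.smult_r_null[OF mono_B[OF y]] .
    then show ?case by (simp add: J_zero zeros)
  next
    case (add v x z c)
    note fm = free_monomial_closed[OF add(3,4), of c]
    have "J (monomial y d \<odot>\<^bsub>?F\<^esub> (v \<oplus>\<^bsub>?F\<^esub> free_monomial x z c))
        = J (monomial y d \<odot>\<^bsub>?F\<^esub> v) \<oplus>\<^bsub>?G\<^esub> J (monomial y d \<odot>\<^bsub>?F\<^esub> free_monomial x z c)"
      using mono_B[OF y, of d] add(1) fm by (simp add: FB.smult_r_distr J_add)
    \<comment> \<open>Here equivariance enters: passing from \<open>z\<close> to \<open>y z\<close>
      multiplies \<open>a z\<close> by \<open>y\<close> and leaves the basis index
      \<open>(x, t z)\<close> in place.\<close>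
    also have "J (monomial y d \<odot>\<^bsub>?F\<^esub> free_monomial x z c) = monomial y d \<odot>\<^bsub>?G\<^esub> J (free_monomial x z c)"
      using y add(4) by (simp add: mono_F mono_G J_mono a_mult t_mult)
    also have "J (monomial y d \<odot>\<^bsub>?F\<^esub> v) \<oplus>\<^bsub>?G\<^esub> (monomial y d \<odot>\<^bsub>?G\<^esub> J (free_monomial x z c))
        = monomial y d \<odot>\<^bsub>?G\<^esub> J (v \<oplus>\<^bsub>?F\<^esub> free_monomial x z c)"
      using mono_B[OF y, of d] add(1,2) fm by (simp add: GB.smult_r_distr J_add J_closed)
    finally show ?case .
  qed
  have J_smult: "J (b \<odot>\<^bsub>?F\<^esub> v) = b \<odot>\<^bsub>?G\<^esub> J v" if b: "b \<in> carrier ?B" and v: "v \<in> carrier ?F" for b v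
    using b
  proof (induct b rule: monoid_algebra_induct)
    case zero
    have "\<zero>\<^bsub>?B\<^esub> \<odot>\<^bsub>?F\<^esub> v = \<zero>\<^bsub>?F\<^esub>" "\<zero>\<^bsub>?B\<^esub> \<odot>\<^bsub>?G\<^esub> J v = \<zero>\<^bsub>?G\<^esub>"
      using FB.smult_l_null[OF v] GB.smult_l_null[OF J_closed[OF v]] .
    then show ?case by (simp add: J_zero zeros monoid_algebra_simps(2))
  next
    case (add f y d)
    then have y: "y \<in> H" by simp
    show ?case
      using add(1,2) mono_B[OF y, of d] v J_closed[OF v]
      by (simp add: FB.smult_l_distr GB.smult_l_distr J_add J_smult1[OF y v])
  qed
  have J_hom: "J \<in> left_module_hom ?B ?F ?G"
    unfolding left_module_hom_def using J_closed J_add J_smult by auto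
  have b_closed: "free_basis ?A x \<in> carrier ?F" if "x \<in> ?X" for x
    by (rule free_basis_closed[OF ring_monoid_algebra[OF M] that])
  \<comment> \<open>Since \<open>\<tau>\<close> is in \<open>M\<close> and perhaps not in
    \<open>H\<close>, this image uses the action of the large algebra on \<open>P\<close>.\<close>
  define m where "m = (\<lambda>(x, \<tau>). monomial \<tau> 1 \<odot>\<^bsub>P\<^esub> q (free_basis ?A x))"
  have m: "m \<in> ?X \<times> ?T \<rightarrow> carrier P"
    using left_module_homD(1)[OF q b_closed] t_closed
    by (auto simp: m_def intro!: PA.smult_closed monomial_closed)
  obtain Q where Q: "Q \<in> left_module_hom ?B ?G P" "\<And>y. y \<in> ?X \<times> ?T \<Longrightarrow> Q (free_basis ?B y) = m y"
    using free_module_universal[OF PB m] by blast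
  have QJ: "Q (J v) = q v" if "v \<in> carrier ?F" for v
    using that
  proof (induct v rule: free_module_monoid_algebra_induct)
    case zero
    show ?case
      using left_module_hom_zero[OF GB PB Q(1)] left_module_hom_zero[OF FA PA q] by (simp add: J_zero zeros)
  next
    case (add v x z c)
    note fm = free_monomial_closed[OF add(3,4), of c]
    have qb: "q (free_basis ?A x) \<in> carrier P" by (rule left_module_homD(1)[OF q b_closed[OF add(3)]])
    have y: "(x, t z) \<in> ?X \<times> ?T" using add by auto
    have "Q (J (free_monomial x z c)) = Q (monomial (a z) c \<odot>\<^bsub>?G\<^esub> free_basis ?B (x, t z))"
      unfolding J_mono
      by (subst free_monomial_eq_smult_basis[OF N, where X = "?X \<times> ?T"]) (simp_all add: a_closed[OF add(4)])
    also have "\<dots> = monomial (a z) c \<odot>\<^bsub>P\<^esub> m (x, t z)"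
      using left_module_homD(3)[OF Q(1) mono_B[OF a_closed[OF add(4)]] free_basis_closed[OF ring_monoid_algebra[OF N] y]]
      by (simp add: Q(2)[OF y])
    also have "\<dots> = (monomial (a z) c \<otimes>\<^bsub>?A\<^esub> monomial (t z) 1) \<odot>\<^bsub>P\<^esub> q (free_basis ?A x)"
      unfolding m_def prod.case
      by (intro PA.smult_assoc1[symmetric] monomial_closed HM a_closed t_closed qb add(4))
    also have "\<dots> = monomial z c \<odot>\<^bsub>P\<^esub> q (free_basis ?A x)"
      by (simp add: monomial_mult at[OF add(4)])
    also have "\<dots> = q (free_monomial x z c)"
      unfolding free_monomial_eq_smult_basis[OF M add(4), where X = ?X]
      by (rule left_module_homD(3)[OF q monomial_closed[OF add(4)] b_closed[OF add(3)], symmetric])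
    finally show ?case
      using add(1,2) fm left_module_homD(2)[OF q] left_module_homD(2)[OF Q(1)] by (simp add: J_add J_closed)
  qed
  show ?thesis
  proof (rule projective_module_retract_free[OF PB])
    show "(\<lambda>x. J (i x)) \<in> left_module_hom ?B P ?G"
      by (rule left_module_hom_compose[OF restrict[OF i] J_hom])
    show "Q \<in> left_module_hom ?B ?G P" by (rule Q(1))
    show "Q (J (i x)) = x" if "x \<in> carrier P" for x
      using QJ[OF left_module_homD(1)[OF i that]] qi[OF that] by simp
  qed
qed

section \<open>Factorisation in the 0-rook monoid\<close>

abbreviation rook_eq :: "nat \<Rightarrow> nat list \<Rightarrow> nat list \<Rightarrow> bool" where
  "rook_eq n \<equiv> presented_eq {..<n} (rook_relations n)"

declare presented_eq.word_trans [trans]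

lemma rook_eq_refl: "set u \<subseteq> {..<n} \<Longrightarrow> rook_eq n u u"
  by (auto intro: presented_eq.word_refl)

lemma rook_eq_append:
  assumes "rook_eq n u v" "set p \<subseteq> {..<n}" "set q \<subseteq> {..<n}"
  shows "rook_eq n (p @ u @ q) (p @ v @ q)"
  by (intro presented_eq.word_mult assms(1) rook_eq_refl assms(2,3))

lemma rook_eq_prepend: "rook_eq n u v \<Longrightarrow> set p \<subseteq> {..<n} \<Longrightarrow> rook_eq n (p @ u) (p @ v)"
  using rook_eq_append[of n u v p "[]"] by simp

lemma rook_eq_postpend: "rook_eq n u v \<Longrightarrow> set q \<subseteq> {..<n} \<Longrightarrow> rook_eq n (u @ q) (v @ q)"
  using rook_eq_append[of n u v "[]" q] by simp

lemma rook_eq_idem: "i < n \<Longrightarrow> rook_eq n [i, i] [i]"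
  by (rule presented_eq.word_rel) (auto simp: rook_relations_def)

lemma rook_eq_braid: "1 \<le> i \<Longrightarrow> Suc i < n \<Longrightarrow> rook_eq n [i, Suc i, i] [Suc i, i, Suc i]"
  by (rule presented_eq.word_rel) (auto simp: rook_relations_def)

lemma rook_eq_comm: "i < n \<Longrightarrow> j < n \<Longrightarrow> i + 2 \<le> j \<or> j + 2 \<le> i \<Longrightarrow> rook_eq n [i, j] [j, i]"
  by (rule presented_eq.word_rel) (auto simp: rook_relations_def)

lemma rook_eq_zero_left: "1 < n \<Longrightarrow> rook_eq n [1, 0, 1, 0] [0, 1, 0]"
  by (rule presented_eq.word_rel) (auto simp: rook_relations_def)

lemma rook_eq_zero_right: "1 < n \<Longrightarrow> rook_eq n [0, 1, 0, 1] [0, 1, 0]"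
  by (rule presented_eq.word_sym, rule presented_eq.word_rel) (auto simp: rook_relations_def)

lemma rook_eq_comm_word:
  assumes "i < n" "\<forall>j\<in>set u. j < n \<and> (i + 2 \<le> j \<or> j + 2 \<le> i)"
  shows "rook_eq n ([i] @ u) (u @ [i])"
  using assms(2)
proof (induct u)
  case Nil
  then show ?case using assms(1) by (auto intro: rook_eq_refl)
next
  case (Cons j u)
  have u: "set u \<subseteq> {..<n}" using Cons.prems by auto
  have "rook_eq n ([i, j] @ u) ([j, i] @ u)"
    using Cons.prems assms(1) u by (intro rook_eq_postpend rook_eq_comm) auto
  also have "rook_eq n ([j, i] @ u) ([j] @ u @ [i])"
    using rook_eq_prepend[of n "[i] @ u" "u @ [i]" "[j]"] Cons by simp
  finally show ?case by simp
qed

text \<open>Moving left, \<open>j\<close> commutes with the letters above \<open>Suc j\<close>,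
  becomes \<open>Suc j\<close> by the braid relation, and commutes with the letters below
  \<open>j\<close>. The cycle may start at \<open>0\<close>, but \<open>j\<close> may not be
  \<open>0\<close>, for which there is no such braid relation.\<close>

lemma rook_eq_shift:
  assumes "p \<le> j" "Suc j < q" "q \<le> n" "1 \<le> j"
  shows "rook_eq n ([p..<q] @ [j]) ([Suc j] @ [p..<q])"
proof -
  let ?u = "[p..<j]" and ?v = "[Suc (Suc j)..<q]"
  have s: "set ?u \<subseteq> {..<n}" "set ?v \<subseteq> {..<n}" using assms by auto
  have split: "[p..<q] = ?u @ [j, Suc j] @ ?v"
    using assms upt_add_eq_append[of p j "q - j"] by (simp add: upt_conv_Cons)
  have "rook_eq n ((?u @ [j, Suc j]) @ ?v @ [j]) ((?u @ [j, Suc j]) @ [j] @ ?v)"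
    by (rule rook_eq_prepend, rule presented_eq.word_sym, rule rook_eq_comm_word)
      (use assms in auto)
  also have "rook_eq n ((?u @ [j, Suc j]) @ [j] @ ?v) (?u @ [Suc j, j, Suc j] @ ?v)"
    using rook_eq_append[OF rook_eq_braid s, of j] assms by simp
  also have "rook_eq n (?u @ [Suc j, j, Suc j] @ ?v) (([Suc j] @ ?u) @ [j, Suc j] @ ?v)"
  proof -
    have "rook_eq n ((?u @ [Suc j]) @ ([j, Suc j] @ ?v)) (([Suc j] @ ?u) @ ([j, Suc j] @ ?v))"
      by (rule rook_eq_postpend, rule presented_eq.word_sym, rule rook_eq_comm_word)
        (use assms in auto)
    then show ?thesis by simp
  qed
  finally show ?thesis unfolding split by simp
qed

lemma rook_eq_shift_word:
  assumes "\<forall>j\<in>set w. p \<le> j \<and> Suc j < q \<and> 1 \<le> j" "q \<le> n"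
  shows "rook_eq n ([p..<q] @ w) (map Suc w @ [p..<q])"
  using assms(1)
proof (induct w)
  case Nil
  then show ?case using assms(2) by (auto intro: rook_eq_refl)
next
  case (Cons j w)
  have "rook_eq n (([p..<q] @ [j]) @ w) (([Suc j] @ [p..<q]) @ w)"
    using Cons.prems assms(2) by (intro rook_eq_postpend rook_eq_shift) auto
  also have "rook_eq n (([Suc j] @ [p..<q]) @ w) ([Suc j] @ map Suc w @ [p..<q])"
    using rook_eq_prepend[of n "[p..<q] @ w" "map Suc w @ [p..<q]" "[Suc j]"] Cons assms(2) by auto
  finally show ?case by simp
qed

section \<open>The action on vectors\<close>

text \<open>Positions count from 1. The descent into the tail stops at \<open>Suc 0\<close>, since
  \<open>0\<close> is the killing generator. Lists too short for the generator are left
  alone.\<close>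

fun rook_act :: "nat \<Rightarrow> nat list \<Rightarrow> nat list" where
  "rook_act 0 (y # vs) = 0 # vs"
| "rook_act (Suc 0) (x # y # vs) = (if x < y then y # x # vs else x # y # vs)"
| "rook_act (Suc (Suc i)) (x # vs) = x # rook_act (Suc i) vs"
| "rook_act _ v = v"

lemma length_rook_act [simp]: "length (rook_act i v) = length v"
  by (induct i v rule: rook_act.induct) auto

lemma length_filter_rook_act: "length (filter P (rook_act (Suc i) v)) = length (filter P v)"
  by (induct "Suc i" v arbitrary: i rule: rook_act.induct) auto

lemma set_rook_act: "set (rook_act (Suc i) v) = set v"
  by (induct "Suc i" v arbitrary: i rule: rook_act.induct) auto

lemma rook_act_idem: "rook_act i (rook_act i v) = rook_act i v"
  by (induct i v rule: rook_act.induct) auto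

lemma rook_act_comm_aux: "rook_act i (rook_act (Suc (Suc (i + k))) v) = rook_act (Suc (Suc (i + k))) (rook_act i v)"
proof (induct i v rule: rook_act.induct)
  case (2 x y vs)
  then show ?case by (cases k) auto
qed (auto split: list.splits)

lemma rook_act_comm:
  "i + 2 \<le> j \<or> j + 2 \<le> i \<Longrightarrow> rook_act i (rook_act j v) = rook_act j (rook_act i v)"
  using rook_act_comm_aux[of i _ v] rook_act_comm_aux[of j _ v] by (auto dest!: le_Suc_ex)

text \<open>Both sides sort three adjacent entries into decreasing order.\<close>

lemma rook_act_braid:
  "Suc (Suc k) < length v \<Longrightarrow>
   rook_act (Suc k) (rook_act (Suc (Suc k)) (rook_act (Suc k) v)) =
   rook_act (Suc (Suc k)) (rook_act (Suc k) (rook_act (Suc (Suc k)) v))"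
proof (induct k arbitrary: v)
  case 0
  then obtain x y z vs where "v = x # y # z # vs"
    by (metis (no_types, lifting) One_nat_def Suc_less_eq length_greater_0_conv length_Suc_conv less_Suc_eq_0_disj list.exhaust list.size(3,4) not_less_zero)
  then show ?case by auto
next
  case (Suc k)
  then show ?case by (cases v) auto
qed

text \<open>On lists with at least two entries, every side replaces the first two by
  \<open>0\<close>.\<close>

lemma rook_act_zero:
  "rook_act 1 (rook_act 0 (rook_act 1 (rook_act 0 v))) = rook_act 0 (rook_act 1 (rook_act 0 v))"
  "rook_act 0 (rook_act 1 (rook_act 0 (rook_act 1 v))) = rook_act 0 (rook_act 1 (rook_act 0 v))"
  by (cases v; cases "tl v"; auto)+

lemma length_foldr_rook_act [simp]: "length (foldr rook_act w v) = length v"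
  by (induct w) auto

text \<open>The generators satisfy the defining relations as operators on lists of length
  \<open>n\<close>, so the vector of a word depends only on its class.\<close>

lemma foldr_rook_act_cong:
  "rook_eq n u u' \<Longrightarrow> length v = n \<Longrightarrow> foldr rook_act u v = foldr rook_act u' v"
proof (induct arbitrary: v rule: presented_eq.induct)
  case (word_rel u u')
  have b: "rook_act i (rook_act (Suc i) (rook_act i v)) = rook_act (Suc i) (rook_act i (rook_act (Suc i) v))"
    if "1 \<le> i" "Suc i < n" for i
    using rook_act_braid[of "i - 1" v] word_rel(2) that by auto
  show ?case using word_rel b
    by (auto simp: rook_relations_def rook_act_idem rook_act_zero[unfolded One_nat_def] rook_act_comm split: if_splits)
qed auto

section \<open>Sorting words\<close>

text \<open>\<open>p\<close> is the position of the head of the list; \<open>\<le>\<close> rather than \<open><\<close> numbers equal letters decreasingly.\<close>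

fun sort_word :: "nat \<Rightarrow> nat list \<Rightarrow> nat list" where
  "sort_word p [] = []"
| "sort_word p (y # vs) = sort_word (Suc p) vs @ [p..<p + length (filter (\<lambda>z. z \<le> y) vs)]"

lemma set_sort_word: "set (sort_word p v) \<subseteq> {p..<p + length v - 1}"
proof (induct p v rule: sort_word.induct)
  case (2 p y vs)
  have "length (filter (\<lambda>z. z \<le> y) vs) \<le> length vs" by simp
  with 2 show ?case by (cases vs) fastforce+
qed simp

text \<open>This is the equivariance of the Hecke factor. With the head at position
  \<open>p\<close>, the generator \<open>p + k\<close> exchanges the entries that
  \<open>rook_act (Suc k)\<close> exchanges. Only the case of the two leading entries needs work: an
  action further right leaves the count for the head unchanged.\<close>

lemma sort_word_rook_act:
  assumes "1 \<le> p" "p + length v \<le> Suc n" "Suc k < length v"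
  shows "rook_eq n ([p + k] @ sort_word p v) (sort_word p (rook_act (Suc k) v))"
  using assms
proof (induct k arbitrary: p v)
  case 0
  then obtain x y vs where v: "v = x # y # vs" by (cases v; cases "tl v") auto
  define s where "s = sort_word (Suc (Suc p)) vs"
  define m where "m z = length (filter (\<lambda>u. u \<le> z) vs)" for z
  have sub: "set s \<subseteq> {Suc (Suc p)..<p + 1 + length vs}" using set_sort_word[of "Suc (Suc p)" vs] by (auto simp: s_def)
  have pn: "Suc p + length vs \<le> n" using 0 v by simp
  have sn: "set s \<subseteq> {..<n}" using sub pn by auto
  have m_le: "m z \<le> length vs" for z by (simp add: m_def)
  \<comment> \<open>The cycles contributed by two neighbouring entries change order; the one that
    moves left has its letters raised by one.\<close>
  have shift: "rook_eq n ([p..<p + Suc a] @ [p..<p + b]) ([Suc p..<Suc p + b] @ [p..<p + Suc a])"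
    if "b \<le> a" "a \<le> length vs" for a b
    using rook_eq_shift_word[of "[p..<p+b]" p "p + Suc a" n] that 0 pn by (simp add: map_Suc_upt)
  have m_mono: "m a \<le> m b" if "a \<le> b" for a b
    unfolding m_def using that by (induct vs) auto
  \<comment> \<open>The letters of \<open>s\<close> are at least \<open>p + 2\<close>, so
    \<open>p\<close> passes them and prolongs the cycle of \<open>y\<close> to the left.\<close>
  have lhs: "rook_eq n ([p] @ s @ [Suc p..<Suc p + m y] @ [p..<p + c]) (s @ [p..<p + Suc (m y)] @ [p..<p + c])"
    if "p + c \<le> n" for c
  proof -
    have "rook_eq n (([p] @ s) @ [Suc p..<Suc p + m y] @ [p..<p + c]) ((s @ [p]) @ [Suc p..<Suc p + m y] @ [p..<p + c])"
      by (intro rook_eq_postpend rook_eq_comm_word) (use sub pn that m_le[of y] in fastforce)+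
    moreover have "[p] @ [Suc p..<Suc p + m y] = [p..<p + Suc (m y)]"
      by (simp add: upt_conv_Cons del: upt_Suc)
    ultimately show ?thesis by (metis append_assoc)
  qed
  show ?case
  proof (cases "x < y")
    case True
    have "rook_eq n ([p] @ s @ [Suc p..<Suc p + m y] @ [p..<p + m x]) (s @ [p..<p + Suc (m y)] @ [p..<p + m x])"
      using lhs[of "m x"] m_le[of x] pn by simp
    also have "rook_eq n \<dots> (s @ [Suc p..<Suc p + m x] @ [p..<p + Suc (m y)])"
      using True by (intro rook_eq_prepend shift m_mono m_le sn) auto
    finally show ?thesis using True by (simp add: v s_def m_def)
  next
    case False
    let ?t = "[p..<p + Suc (m x)]"
    have yx: "m y \<le> m x" using False by (intro m_mono) auto
    have cs: "set [Suc p..<Suc p + m y] \<subseteq> {..<n}" "set [p..<p + m y] \<subseteq> {..<n}"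
      "set ([Suc p..<p + Suc (m x)] @ [p..<p + m y]) \<subseteq> {..<n}"
      using m_le[of y] m_le[of x] pn by auto
    \<comment> \<open>Here the vector is fixed, so \<open>p\<close> has to be absorbed. Exchanging
      the cycles backwards brings \<open>?t\<close> next to \<open>s\<close>; its first letter
      \<open>p\<close> absorbs the extra \<open>p\<close> by idempotence, and the exchange is then
      redone. This covers \<open>x = y\<close>, hence two adjacent zeros.\<close>
    have "rook_eq n ([p] @ s @ [Suc p..<Suc p + m y] @ ?t) (([p] @ s) @ ?t @ [p..<p + m y])"
      using rook_eq_prepend[OF presented_eq.word_sym[OF shift[OF yx m_le]], of "[p] @ s"] sn pn by auto
    also have "rook_eq n (([p] @ s) @ ?t @ [p..<p + m y]) ((s @ [p]) @ ?t @ [p..<p + m y])"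
      by (intro rook_eq_postpend rook_eq_comm_word) (use sub pn m_le[of x] m_le[of y] in fastforce)+
    also have "rook_eq n ((s @ [p]) @ ?t @ [p..<p + m y]) (s @ ?t @ [p..<p + m y])"
    proof -
      have "?t = [p] @ [Suc p..<p + Suc (m x)]" by (simp add: upt_conv_Cons del: upt_Suc)
      then show ?thesis using rook_eq_append[OF rook_eq_idem sn cs(3), of p] pn by (simp del: upt_Suc)
    qed
    also have "rook_eq n \<dots> (s @ [Suc p..<Suc p + m y] @ ?t)"
      by (intro rook_eq_prepend shift yx m_le sn)
    finally show ?thesis using False by (simp add: v s_def m_def)
  qed
next
  case (Suc k)
  then obtain x vs where v: "v = x # vs" by (cases v) auto
  have "p + length (filter (\<lambda>z. z \<le> x) vs) \<le> p + length vs" by simp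
  also have "\<dots> \<le> n" using Suc.prems v by simp
  finally have l: "set [p..<p + length (filter (\<lambda>z. z \<le> x) vs)] \<subseteq> {..<n}" by auto
  have "rook_eq n (([Suc p + k] @ sort_word (Suc p) vs) @ [p..<p + length (filter (\<lambda>z. z \<le> x) vs)])
     (sort_word (Suc p) (rook_act (Suc k) vs) @ [p..<p + length (filter (\<lambda>z. z \<le> x) vs)])"
    by (intro rook_eq_postpend Suc.hyps l) (use Suc.prems v in auto)
  then show ?case by (simp add: v length_filter_rook_act)
qed

section \<open>Killing words\<close>

text \<open>\<open>[0..<d]\<close> moves the letter \<open>d\<close> to the front and kills it. The smallest letter is killed first, when all
  killed letters are still in place; words act from the right end.\<close>

fun kill_word :: "nat list \<Rightarrow> nat list" where
  "kill_word [] = []"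
| "kill_word (d # ds) = kill_word ds @ [0..<d]"

lemma set_kill_word: "set ds \<subseteq> {..n} \<Longrightarrow> set (kill_word ds) \<subseteq> {..<n}"
  by (induct ds) auto

text \<open>Two orders of killing \<open>s < d\<close>: once \<open>d\<close> is killed,
  \<open>s\<close> sits at position \<open>Suc s\<close>; if \<open>s\<close> goes first,
  \<open>d\<close> stays in place. In words, \<open>[2..<Suc s]\<close> passes the cycle and becomes
  \<open>[1..<s]\<close>, then \<open>0 1 0 1\<close> collapses to \<open>0 1 0\<close>, and the
  last \<open>0\<close> moves past \<open>[2..<d]\<close>.\<close>

lemma rook_eq_cycle_swap:
  assumes "1 \<le> s" "s < d" "d \<le> n"
  shows "rook_eq n ([0..<Suc s] @ [0..<d]) ([0..<d] @ [0..<s])"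
proof -
  have d: "[0..<d] = [0, 1] @ [2..<d]" and s: "[0..<s] = [0] @ [1..<s]" "[0..<Suc s] = [0, 1] @ [2..<Suc s]"
    using assms by (simp_all add: upt_conv_Cons numeral_2_eq_2)
  have "rook_eq n ([0, 1] @ [2..<Suc s] @ [0..<d]) ([0, 1] @ [0..<d] @ [1..<s])"
    using presented_eq.word_sym[OF rook_eq_shift_word[of "[1..<s]" 0 d n]] assms
    by (intro rook_eq_prepend) (auto simp: map_Suc_upt numeral_2_eq_2)
  also have "rook_eq n \<dots> ([0, 1, 0] @ [2..<d] @ [1..<s])"
  proof -
    have "set ([2..<d] @ [1..<s]) \<subseteq> {..<n}" "1 < n" using assms by auto
    then show ?thesis
      using rook_eq_postpend[OF rook_eq_zero_right, of n "[2..<d] @ [1..<s]"] by (simp add: d)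
  qed
  also have "rook_eq n \<dots> ([0, 1] @ [2..<d] @ [0] @ [1..<s])"
  proof -
    have "rook_eq n ([0,1] @ ([0] @ [2..<d]) @ [1..<s]) ([0,1] @ ([2..<d] @ [0]) @ [1..<s])"
      by (intro rook_eq_append rook_eq_comm_word) (use assms in auto)
    then show ?thesis by simp
  qed
  finally show ?thesis unfolding s d by simp
qed

text \<open>Each larger letter already killed has pushed \<open>y\<close> one place to the right.
  Moving the cycle through the blocks by \<open>rook_eq_cycle_swap\<close> takes off one letter per
  block.\<close>

lemma kill_word_snoc:
  assumes "1 \<le> y" "y \<le> n" "sorted_wrt (<) ds" "\<forall>d\<in>set ds. y < d \<and> d \<le> n"
  shows "rook_eq n ([0..<y + length ds] @ kill_word ds) (kill_word ds @ [0..<y])"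
  using assms
proof (induct ds arbitrary: y)
  case (Cons d ds)
  have k: "set (kill_word ds) \<subseteq> {..<n}" using Cons.prems by (intro set_kill_word) auto
  have "rook_eq n (([0..<Suc y + length ds] @ kill_word ds) @ [0..<d]) ((kill_word ds @ [0..<Suc y]) @ [0..<d])"
    by (intro rook_eq_postpend Cons.hyps) (use Cons.prems in fastforce)+
  also have "rook_eq n ((kill_word ds @ [0..<Suc y]) @ [0..<d]) (kill_word ds @ [0..<d] @ [0..<y])"
    using rook_eq_prepend[OF rook_eq_cycle_swap k, of y d] Cons.prems by auto
  finally show ?case by simp
qed (auto intro: rook_eq_refl)

text \<open>Killing \<open>y\<close> after \<open>ds\<close>: only the killed letters above
  \<open>y\<close> have displaced it, so its cycle passes just their blocks to reach its place in
  the sorted order.\<close>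

lemma kill_word_insort:
  assumes "1 \<le> y" "y \<le> n" "sorted_wrt (<) ds" "set ds \<subseteq> {1..n}" "y \<notin> set ds"
  shows "rook_eq n ([0..<y + length (filter (\<lambda>d. y < d) ds)] @ kill_word ds) (kill_word (insort y ds))"
  using assms
proof (induct ds)
  case Nil
  then show ?case by (auto intro: rook_eq_refl)
next
  case (Cons d ds)
  show ?case
  proof (cases "y < d")
    case True
    then have "filter (\<lambda>d. y < d) (d # ds) = d # ds" using Cons.prems by (intro filter_True) auto
    moreover have "rook_eq n ([0..<y + length (d # ds)] @ kill_word (d # ds)) (kill_word (d # ds) @ [0..<y])"
      by (rule kill_word_snoc) (use Cons.prems True in auto)
    ultimately show ?thesis using True by (simp del: upt_Suc)
  next
    case False
    have "rook_eq n (([0..<y + length (filter (\<lambda>d. y < d) ds)] @ kill_word ds) @ [0..<d])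
        (kill_word (insort y ds) @ [0..<d])"
      by (intro rook_eq_postpend Cons.hyps) (use Cons.prems in auto)
    then show ?thesis using False Cons.prems(5) by simp
  qed
qed

text \<open>Each killing of a letter beyond \<open>Suc j\<close> moves the entries at positions
  \<open>j\<close> and \<open>Suc j\<close> one place to the right.\<close>

lemma kill_word_shift:
  assumes "1 \<le> j" "sorted_wrt (<) ds" "\<forall>d\<in>set ds. Suc j < d \<and> d \<le> n" "j < n"
  shows "rook_eq n ([j + length ds] @ kill_word ds) (kill_word ds @ [j])"
  using assms
proof (induct ds arbitrary: j)
  case (Cons d ds)
  have k: "set (kill_word ds) \<subseteq> {..<n}" using Cons.prems by (intro set_kill_word) auto
  have "rook_eq n (([Suc j + length ds] @ kill_word ds) @ [0..<d]) ((kill_word ds @ [Suc j]) @ [0..<d])"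
    by (intro rook_eq_postpend Cons.hyps) (use Cons.prems in fastforce)+
  also have "rook_eq n ((kill_word ds @ [Suc j]) @ [0..<d]) (kill_word ds @ [0..<d] @ [j])"
    using rook_eq_prepend[OF presented_eq.word_sym[OF rook_eq_shift] k, of 0 j d] Cons.prems by auto
  finally show ?case by simp
qed (auto intro: rook_eq_refl)

text \<open>After two killings the first two entries are zero, and the generator \<open>1\<close>
  fixes them. In words, both zeros are gathered into \<open>0 1 0\<close>, which absorbs a
  \<open>1\<close> on its left.\<close>

lemma rook_eq_cycle_absorb:
  assumes "1 \<le> d" "d < e" "e \<le> n"
  shows "rook_eq n ([1] @ [0..<e] @ [0..<d]) ([0..<e] @ [0..<d])"
proof -
  let ?w = "[2..<e] @ [1..<d]"
  have e: "[0..<e] = [0, 1] @ [2..<e]" and d: "[0..<d] = [0] @ [1..<d]"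
    using assms by (simp_all add: upt_conv_Cons numeral_2_eq_2)
  have w: "set ?w \<subseteq> {..<n}" and n: "1 < n" using assms by auto
  have c: "rook_eq n (p @ [0, 1] @ [2..<e] @ [0] @ [1..<d]) (p @ [0, 1, 0] @ ?w)" if "set p \<subseteq> {..<n}" for p
  proof -
    have "rook_eq n ((p @ [0,1]) @ ([2..<e] @ [0]) @ [1..<d]) ((p @ [0,1]) @ ([0] @ [2..<e]) @ [1..<d])"
      by (intro rook_eq_append presented_eq.word_sym[OF rook_eq_comm_word]) (use assms that in auto)
    then show ?thesis by simp
  qed
  have "rook_eq n ([1] @ [0, 1] @ [2..<e] @ [0] @ [1..<d]) ([1] @ [0, 1, 0] @ ?w)" using n by (intro c) auto
  also have "rook_eq n ([1] @ [0, 1, 0] @ ?w) ([0, 1, 0] @ ?w)"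
    using rook_eq_postpend[OF rook_eq_zero_left[OF n] w] by simp
  also have "rook_eq n ([0, 1, 0] @ ?w) ([0, 1] @ [2..<e] @ [0] @ [1..<d])"
    using presented_eq.word_sym[OF c[of "[]"]] by simp
  finally show ?thesis unfolding d e by simp
qed

text \<open>After \<open>ds\<close> is killed, the first \<open>length ds\<close> entries are zero,
  so these generators do nothing.\<close>

lemma kill_word_absorb:
  assumes "sorted_wrt (<) ds" "set ds \<subseteq> {1..n}" "i < length ds"
  shows "rook_eq n ([i] @ kill_word ds) (kill_word ds)"
  using assms
proof (induct ds)
  case (Cons d ds)
  show ?case
  proof (cases "i < length ds")
    case True
    have "rook_eq n (([i] @ kill_word ds) @ [0..<d]) (kill_word ds @ [0..<d])"
      by (intro rook_eq_postpend Cons.hyps) (use Cons.prems True in auto)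
    then show ?thesis by simp
  next
    case False
    \<comment> \<open>Only the generator gained from \<open>d\<close> is left. It is
      \<open>0\<close> if \<open>d\<close> is the sole letter; otherwise it moves right through all
      but two blocks, arrives as \<open>1\<close>, and is absorbed there.\<close>
    then have i: "i = length ds" using Cons.prems by simp
    show ?thesis
    proof (cases ds)
      case Nil
      have "set [1..<d] \<subseteq> {..<n}" using Cons.prems by auto
      then have "rook_eq n ([0, 0] @ [1..<d]) ([0] @ [1..<d])"
        using Cons.prems by (intro rook_eq_postpend rook_eq_idem) auto
      moreover have "[0..<d] = [0] @ [1..<d]" using Cons.prems by (simp add: upt_conv_Cons)
      ultimately show ?thesis using i Nil by simp
    next
      case (Cons e es)
      note prems = Cons.prems[unfolded Cons]
      have k: "set (kill_word es) \<subseteq> {..<n}" using prems by (intro set_kill_word) auto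
      have "rook_eq n (([1 + length es] @ kill_word es) @ [0..<e] @ [0..<d]) ((kill_word es @ [1]) @ [0..<e] @ [0..<d])"
        by (intro rook_eq_postpend kill_word_shift) (use prems in fastforce)+
      also have "rook_eq n ((kill_word es @ [1]) @ [0..<e] @ [0..<d]) (kill_word es @ [0..<e] @ [0..<d])"
        using rook_eq_prepend[OF rook_eq_cycle_absorb k, of d e] prems by auto
      finally show ?thesis using i Cons by simp
    qed
  qed
qed simp

lemma kill_word_absorb_word:
  assumes "sorted_wrt (<) ds" "set ds \<subseteq> {1..n}" "set w \<subseteq> {..<length ds}"
  shows "rook_eq n (w @ kill_word ds) (kill_word ds)"
  using assms(3)
proof (induct w)
  case Nil
  then show ?case using assms by (auto intro!: rook_eq_refl set_kill_word)
next
  case (Cons i w)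
  have "length ds \<le> n"
    using assms(1,2) card_mono[of "{1..n}" "set ds"] by (simp add: distinct_card strict_sorted_iff)
  then have "rook_eq n ([i] @ (w @ kill_word ds)) ([i] @ kill_word ds)"
    using Cons by (intro rook_eq_prepend) auto
  also have "rook_eq n ([i] @ kill_word ds) (kill_word ds)"
    using Cons assms by (intro kill_word_absorb) auto
  finally show ?case by simp
qed

section \<open>Rook vectors and the normal form\<close>

text \<open>One-line notation of a partial permutation, with \<open>0\<close> where it is
  undefined.\<close>

definition rook_vector :: "nat \<Rightarrow> nat list \<Rightarrow> bool" where
  "rook_vector n v \<longleftrightarrow> length v = n \<and> set v \<subseteq> {..n} \<and> distinct (filter (\<lambda>z. 0 < z) v)"

definition missing :: "nat \<Rightarrow> nat list \<Rightarrow> nat list" where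
  "missing n v = sorted_list_of_set ({1..n} - set v)"

lemma rook_vector_act:
  assumes "rook_vector n v"
  shows "rook_vector n (rook_act i v)"
proof (cases i)
  case 0
  then show ?thesis using assms by (cases v) (auto simp: rook_vector_def split: if_splits)
next
  case (Suc k)
  have "distinct (filter P (rook_act (Suc k) v)) = distinct (filter P v)" for P
    by (induct "Suc k" v arbitrary: k rule: rook_act.induct) (auto simp: set_rook_act)
  then show ?thesis using assms Suc by (simp add: rook_vector_def set_rook_act)
qed

lemma rook_vector_foldr: "rook_vector n v \<Longrightarrow> rook_vector n (foldr rook_act w v)"
  by (induct w) (auto intro: rook_vector_act)

lemma rook_vector_one: "rook_vector n [1..<Suc n]"
  by (auto simp: rook_vector_def)

lemma missing_props: "sorted_wrt (<) (missing n v)" "set (missing n v) = {1..n} - set v"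
  by (simp_all add: missing_def)

lemma set_sort_word_rook: "length v = n \<Longrightarrow> set (sort_word 1 v) \<subseteq> {1..<n}"
  using set_sort_word[of 1 v] by simp

text \<open>Counting above \<open>y\<close> avoids the zeros, the only letters a rook vector may repeat.\<close>

lemma length_filter_missing:
  assumes "rook_vector n v"
  shows "length (filter (\<lambda>z. y < z) v) + length (filter (\<lambda>d. y < d) (missing n v)) = n - y"
proof -
  have "distinct (filter (\<lambda>z. y < z) (filter (\<lambda>z. 0 < z) v))"
    using assms unfolding rook_vector_def by (blast intro: distinct_filter)
  moreover have "filter (\<lambda>z. y < z) (filter (\<lambda>z. 0 < z) v) = filter (\<lambda>z. y < z) v"
    by (auto intro: filter_cong)
  ultimately have "length (filter (\<lambda>z. y < z) v) = card (set v \<inter> {y<..n})"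
    using assms by (subst distinct_card[symmetric]) (auto simp: rook_vector_def intro!: arg_cong[where f=card])
  moreover have "length (filter (\<lambda>d. y < d) (missing n v)) = card ({y<..n} - set v)"
    by (subst distinct_card[symmetric]) (auto simp: missing_def intro!: arg_cong[where f=card])
  moreover have "card (({y<..n} - set v) \<union> (set v \<inter> {y<..n})) = card ({y<..n} - set v) + card (set v \<inter> {y<..n})"
    by (rule card_Un_disjoint) auto
  moreover have "({y<..n} - set v) \<union> (set v \<inter> {y<..n}) = {y<..n}" by auto
  ultimately show ?thesis by simp
qed

lemma length_missing:
  assumes "rook_vector n v"
  shows "length (missing n v) = length (filter (\<lambda>z. z = 0) v)"
proof -
  have "filter (\<lambda>d. 0 < d) (missing n v) = missing n v" by (auto simp: missing_def filter_id_conv)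
  then show ?thesis
    using length_filter_missing[OF assms, of 0] sum_length_filter_compl[of "\<lambda>z. z = 0" v] assms
    by (simp add: rook_vector_def)
qed

text \<open>Killing the head \<open>y\<close> affects both factors. The \<open>0\<close> passes
  \<open>s\<close> and turns the cycle of \<open>y\<close> into \<open>[0..<Suc r]\<close>, which is
  exactly the cycle that kills \<open>y\<close> in front of the present killing word.\<close>

lemma sort_kill_zero:
  assumes v: "rook_vector n v" and n: "0 < n"
  shows "rook_eq n ([0] @ sort_word 1 v @ kill_word (missing n v))
    (sort_word 1 (rook_act 0 v) @ kill_word (missing n (rook_act 0 v)))"
proof -
  obtain y vs where yv: "v = y # vs" using v n by (cases v) (auto simp: rook_vector_def)
  have v': "rook_vector n (0 # vs)" using rook_vector_act[OF v, of 0] by (simp add: yv)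
  define s where "s = sort_word 2 vs"
  define r where "r = length (filter (\<lambda>z. z \<le> y) vs)"
  define m where "m = length (filter (\<lambda>z. z = 0) vs)"
  have nv: "n = Suc (length vs)" using v yv by (simp add: rook_vector_def)
  have s: "set s \<subseteq> {2..<n}" using set_sort_word[of 2 vs] nv by (auto simp: s_def)
  have sn: "set s \<subseteq> {..<n}" using s by auto
  have rn: "r \<le> length vs" by (simp add: r_def)
  have K: "set (kill_word (missing n u)) \<subseteq> {..<n}" for u by (rule set_kill_word) (auto simp: missing_props)
  \<comment> \<open>The vector \<open>0 # vs\<close> has \<open>Suc m\<close> zeros, hence as many
    missing letters, so letters up to \<open>m\<close> are absorbed.\<close>
  have absorb: "rook_eq n (s @ w @ kill_word (missing n (0 # vs))) (s @ kill_word (missing n (0 # vs)))"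
    if "set w \<subseteq> {..m}" for w
    using length_missing[OF v'] that
    by (intro rook_eq_prepend kill_word_absorb_word missing_props sn) (auto simp: missing_props m_def)
  have "rook_eq n (([0] @ s) @ [1..<Suc r] @ kill_word (missing n v)) ((s @ [0]) @ [1..<Suc r] @ kill_word (missing n v))"
    by (intro rook_eq_postpend rook_eq_comm_word) (use s K rn nv in auto)
  also have "(s @ [0]) @ [1..<Suc r] @ kill_word (missing n v) = s @ [0..<Suc r] @ kill_word (missing n v)"
    by (simp add: upt_conv_Cons del: upt_Suc)
  also have "rook_eq n \<dots> (s @ kill_word (missing n (0 # vs)))"
  proof (cases "y = 0")
    case True
    then have "set [0..<Suc r] \<subseteq> {..m}" by (auto simp: r_def m_def)
    from absorb[OF this] show ?thesis using True yv by (simp del: upt_Suc)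
  next
    case False
    have y: "1 \<le> y" "y \<le> n" using False v yv by (auto simp: rook_vector_def)
    have "y \<notin> set vs" using v False by (auto simp: rook_vector_def yv)
    then have ins: "missing n (0 # vs) = insort y (missing n v)"
    proof -
      have eq: "{1..n} - set (0 # vs) = insert y ({1..n} - set v)"
        using y \<open>y \<notin> set vs\<close> by (auto simp: yv)
      show ?thesis unfolding missing_def eq by (rule sorted_list_of_set_insert) (simp_all add: yv)
    qed
    have "length (filter (\<lambda>z. y < z) vs) + r = length vs"
      unfolding r_def using sum_length_filter_compl[of "\<lambda>z. y < z" vs] by (simp add: not_less)
    \<comment> \<open>The length of the cycle agrees with \<open>kill_word_insort\<close>: both
      sides are \<open>n\<close> minus the number of entries of \<open>v\<close> above
      \<open>y\<close>.\<close>
    then have "Suc r = y + length (filter (\<lambda>d. y < d) (missing n v))"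
      using length_filter_missing[OF v, of y] y nv by (simp add: yv)
    then have "rook_eq n ([0..<Suc r] @ kill_word (missing n v)) (kill_word (missing n (0 # vs)))"
      unfolding ins using y yv kill_word_insort[of y n "missing n v"] by (simp add: missing_props del: upt_Suc)
    then show ?thesis by (intro rook_eq_prepend sn)
  qed
  \<comment> \<open>Absorption read backwards supplies the cycle that \<open>sort_word\<close>
    attaches to a leading zero.\<close>
  also have "rook_eq n \<dots> (s @ [1..<Suc m] @ kill_word (missing n (0 # vs)))"
    by (rule presented_eq.word_sym[OF absorb]) auto
  finally show ?thesis by (simp add: yv s_def r_def m_def numeral_2_eq_2 del: upt_Suc)
qed

lemma sort_kill_pos:
  assumes "length v = n" "1 \<le> i" "i < n"
  shows "rook_eq n ([i] @ sort_word 1 v) (sort_word 1 (rook_act i v))" "missing n (rook_act i v) = missing n v"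
  using sort_word_rook_act[of 1 v n "i - 1"] assms set_rook_act[of "i - 1" v] by (simp_all add: missing_def)

lemma sort_word_sorted: "sorted_wrt (<) v \<Longrightarrow> sort_word p v = []"
  by (induct v arbitrary: p) (auto simp: filter_empty_conv)

text \<open>Letters are added on the left, and both factors follow the vector by
  \<open>sort_kill_zero\<close> and \<open>sort_kill_pos\<close>. The right side depends on
  \<open>w\<close> only through its vector.\<close>

lemma rook_normal_form:
  assumes "set w \<subseteq> {..<n}"
  defines "v \<equiv> foldr rook_act w [1..<Suc n]"
  shows "rook_eq n w (sort_word 1 v @ kill_word (missing n v))"
  using assms(1) unfolding v_def
proof (induct w)
  case Nil
  \<comment> \<open>The starting vector is increasing and has no missing letter, so both factors are
    empty.\<close>
  have "set [1..<Suc n] = {1..n}" by auto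
  then have "missing n [1..<Suc n] = []" by (simp add: missing_def del: upt_Suc set_upt)
  then show ?case by (auto simp: sort_word_sorted simp del: upt_Suc intro: rook_eq_refl)
next
  case (Cons i w)
  let ?v = "foldr rook_act w [1..<Suc n]"
  have v: "rook_vector n ?v" by (intro rook_vector_foldr rook_vector_one)
  have "rook_eq n ([i] @ w) ([i] @ sort_word 1 ?v @ kill_word (missing n ?v))"
    using Cons by (intro rook_eq_prepend) auto
  also have "rook_eq n \<dots> (sort_word 1 (rook_act i ?v) @ kill_word (missing n (rook_act i ?v)))"
  proof (cases "i = 0")
    case True
    then show ?thesis using sort_kill_zero[OF v] Cons.prems by simp
  next
    case False
    have "set (kill_word (missing n ?v)) \<subseteq> {..<n}" by (rule set_kill_word) (auto simp: missing_props)
    then show ?thesis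
      using rook_eq_postpend[OF sort_kill_pos(1)[of ?v n i]] sort_kill_pos(2)[of ?v n i] False Cons.prems v
      by (simp add: rook_vector_def del: upt_Suc)
  qed
  finally show ?case by simp
qed

text \<open>Positive generators only permute entries, so the missing letters persist and the sorting
  word alone takes up the multiplication.\<close>

lemma sort_word_hecke:
  assumes "set w \<subseteq> {1..<n}" "length v = n"
  shows "rook_eq n (w @ sort_word 1 v) (sort_word 1 (foldr rook_act w v))" "missing n (foldr rook_act w v) = missing n v"
proof -
  have "rook_eq n (w @ sort_word 1 v) (sort_word 1 (foldr rook_act w v)) \<and> missing n (foldr rook_act w v) = missing n v"
    using assms(1)
  proof (induct w)
    case Nil
    have "set (sort_word 1 v) \<subseteq> {..<n}" using set_sort_word_rook[OF assms(2)] by auto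
    then show ?case by (auto intro: rook_eq_refl)
  next
    case (Cons i w)
    have "rook_eq n ([i] @ (w @ sort_word 1 v)) ([i] @ sort_word 1 (foldr rook_act w v))"
      using Cons by (intro rook_eq_prepend) auto
    also have "rook_eq n \<dots> (sort_word 1 (rook_act i (foldr rook_act w v)))"
      using Cons.prems assms(2) by (intro sort_kill_pos) auto
    finally show ?case using Cons sort_kill_pos(2)[of "foldr rook_act w v" n i] assms(2) by simp
  qed
  then show "rook_eq n (w @ sort_word 1 v) (sort_word 1 (foldr rook_act w v))" "missing n (foldr rook_act w v) = missing n v"
    by blast+
qed

section \<open>The factorisation on classes\<close>

text \<open>The choice of representative is immaterial by
  \<open>foldr_rook_act_cong\<close>.\<close>

definition rook_vec :: "nat \<Rightarrow> nat list set \<Rightarrow> nat list" where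
  "rook_vec n x = foldr rook_act (SOME w. set w \<subseteq> {..<n} \<and> x = word_class {..<n} (rook_relations n) w) [1..<Suc n]"

lemma rook_vec_class:
  assumes "set w \<subseteq> {..<n}"
  shows "rook_vec n (word_class {..<n} (rook_relations n) w) = foldr rook_act w [1..<Suc n]"
proof -
  let ?c = "word_class {..<n} (rook_relations n)"
  define u where "u = (SOME u. set u \<subseteq> {..<n} \<and> ?c w = ?c u)"
  have "set u \<subseteq> {..<n} \<and> ?c w = ?c u" unfolding u_def by (rule someI[of _ w]) (use assms in simp)
  moreover have "w \<in> lists {..<n}" using assms by auto
  ultimately have "rook_eq n u w" using word_class_eq_iff[of w] by (blast intro: presented_eq.word_sym)
  then show ?thesis unfolding rook_vec_def u_def[symmetric] by (rule foldr_rook_act_cong) simp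
qed

text \<open>Classes of words in positive letters form a submonoid containing the generators, so the
  intersection defining the Hecke monoid lies inside it.\<close>

lemma hecke_carrier:
  assumes "h \<in> carrier (hecke_monoid n)"
  obtains w where "set w \<subseteq> {1..<n}" "h = word_class {..<n} (rook_relations n) w"
proof -
  let ?c = "word_class {..<n} (rook_relations n)"
  have sub: "lists {1..<n} \<subseteq> lists {..<n}" by (rule lists_mono) auto
  have "submonoid (?c ` lists {1..<n}) (rook_monoid n)"
  proof
    show "?c ` lists {1..<n} \<subseteq> carrier (rook_monoid n)"
      using sub by (auto simp: rook_monoid_def presented_monoid_def)
    show "\<one>\<^bsub>rook_monoid n\<^esub> \<in> ?c ` lists {1..<n}" by (auto simp: rook_monoid_def presented_monoid_def)
    fix x y assume "x \<in> ?c ` lists {1..<n}" "y \<in> ?c ` lists {1..<n}"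
    then obtain u v where "u \<in> lists {1..<n}" "v \<in> lists {1..<n}" "x = ?c u" "y = ?c v" by blast
    moreover from this have "?c u \<otimes>\<^bsub>rook_monoid n\<^esub> ?c v = ?c (u @ v)"
      unfolding rook_monoid_def using sub by (intro word_class_mult) auto
    ultimately show "x \<otimes>\<^bsub>rook_monoid n\<^esub> y \<in> ?c ` lists {1..<n}"
      by (metis append_in_lists_conv imageI)
  qed
  moreover have "{rook_gen n i |i. 1 \<le> i \<and> i < n} \<subseteq> ?c ` lists {1..<n}" by (auto simp: rook_gen_def)
  ultimately have "h \<in> ?c ` lists {1..<n}"
    using assms unfolding hecke_monoid_def generated_submonoid_def by auto
  then show ?thesis using that by (auto simp: lists_eq_set)
qed

lemma word_class_hecke:
  assumes "set w \<subseteq> {1..<n}"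
  shows "word_class {..<n} (rook_relations n) w \<in> carrier (hecke_monoid n)"
  using assms
proof (induct w)
  case Nil
  then show ?case using submonoid.one_closed[OF submonoid_hecke_monoid, of n]
    by (simp add: rook_monoid_def presented_monoid_def)
next
  case (Cons i w)
  have "rook_gen n i \<in> carrier (hecke_monoid n)"
    using Cons.prems unfolding hecke_monoid_def generated_submonoid_def by auto
  then have "rook_gen n i \<otimes>\<^bsub>rook_monoid n\<^esub> word_class {..<n} (rook_relations n) w \<in> carrier (hecke_monoid n)"
    using Cons by (intro submonoid.m_closed[OF submonoid_hecke_monoid]) auto
  moreover have "rook_gen n i \<otimes>\<^bsub>rook_monoid n\<^esub> word_class {..<n} (rook_relations n) w = word_class {..<n} (rook_relations n) ([i] @ w)"
    unfolding rook_gen_def rook_monoid_def by (rule word_class_mult) (use Cons.prems in auto)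
  ultimately show ?case by simp
qed

text \<open>\<open>hecke_part\<close> and \<open>rook_part\<close> serve as \<open>a\<close> and
  \<open>t\<close> in \<open>projective_module_restrict_submonoid\<close>.\<close>

definition hecke_part :: "nat \<Rightarrow> nat list set \<Rightarrow> nat list set" where
  "hecke_part n x = word_class {..<n} (rook_relations n) (sort_word 1 (rook_vec n x))"

definition rook_part :: "nat \<Rightarrow> nat list set \<Rightarrow> nat list set" where
  "rook_part n x = word_class {..<n} (rook_relations n) (kill_word (missing n (rook_vec n x)))"

lemma rook_factorisation:
  assumes "x \<in> carrier (rook_monoid n)"
  shows "hecke_part n x \<in> carrier (hecke_monoid n)" "rook_part n x \<in> carrier (rook_monoid n)"
    "hecke_part n x \<otimes>\<^bsub>rook_monoid n\<^esub> rook_part n x = x"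
proof -
  let ?c = "word_class {..<n} (rook_relations n)"
  obtain w where w: "set w \<subseteq> {..<n}" "x = ?c w"
    using assms by (auto simp: rook_monoid_def presented_monoid_def lists_eq_set)
  define v where "v = foldr rook_act w [1..<Suc n]"
  have v: "rook_vec n x = v" unfolding v_def w(2) by (rule rook_vec_class[OF w(1)])
  have s: "set (sort_word 1 v) \<subseteq> {1..<n}" by (rule set_sort_word_rook) (simp add: v_def)
  have k: "set (kill_word (missing n v)) \<subseteq> {..<n}" by (rule set_kill_word) (auto simp: missing_props)
  show "hecke_part n x \<in> carrier (hecke_monoid n)"
    unfolding hecke_part_def v by (rule word_class_hecke[OF s])
  show "rook_part n x \<in> carrier (rook_monoid n)"
    unfolding rook_part_def v using k by (auto simp: rook_monoid_def presented_monoid_def)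
  have "hecke_part n x \<otimes>\<^bsub>rook_monoid n\<^esub> rook_part n x = ?c (sort_word 1 v @ kill_word (missing n v))"
    unfolding hecke_part_def rook_part_def v rook_monoid_def using s k by (intro word_class_mult) auto
  also have "\<dots> = x"
    unfolding w(2) using rook_normal_form[OF w(1)] w(1)
    by (subst eq_commute, subst word_class_eq_iff) (auto simp: v_def simp del: upt_Suc)
  finally show "hecke_part n x \<otimes>\<^bsub>rook_monoid n\<^esub> rook_part n x = x" .
qed

lemma rook_factorisation_hecke:
  assumes "h \<in> carrier (hecke_monoid n)" "x \<in> carrier (rook_monoid n)"
  shows "hecke_part n (h \<otimes>\<^bsub>rook_monoid n\<^esub> x) = h \<otimes>\<^bsub>rook_monoid n\<^esub> hecke_part n x"
    "rook_part n (h \<otimes>\<^bsub>rook_monoid n\<^esub> x) = rook_part n x"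
proof -
  let ?c = "word_class {..<n} (rook_relations n)"
  obtain w where w: "set w \<subseteq> {..<n}" "x = ?c w"
    using assms by (auto simp: rook_monoid_def presented_monoid_def lists_eq_set)
  obtain u where u: "set u \<subseteq> {1..<n}" "h = ?c u" using assms hecke_carrier by blast
  have un: "set u \<subseteq> {..<n}" using u by auto
  define v where "v = foldr rook_act w [1..<Suc n]"
  have v: "rook_vec n x = v" unfolding v_def w(2) by (rule rook_vec_class[OF w(1)])
  have len: "length v = n" by (simp add: v_def)
  have s: "set (sort_word 1 v) \<subseteq> {..<n}" using set_sort_word_rook[OF len] by auto
  have "h \<otimes>\<^bsub>rook_monoid n\<^esub> x = ?c (u @ w)"
    unfolding u w rook_monoid_def using un w by (intro word_class_mult) auto
  then have hv: "rook_vec n (h \<otimes>\<^bsub>rook_monoid n\<^esub> x) = foldr rook_act u v"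
    using rook_vec_class[of "u @ w" n] un w by (simp add: v_def del: upt_Suc)
  have "h \<otimes>\<^bsub>rook_monoid n\<^esub> hecke_part n x = ?c (u @ sort_word 1 v)"
    unfolding u hecke_part_def v rook_monoid_def using un s by (intro word_class_mult) auto
  also have "\<dots> = ?c (sort_word 1 (foldr rook_act u v))"
    using sort_word_hecke(1)[OF u(1) len] un s by (subst word_class_eq_iff) auto
  finally show "hecke_part n (h \<otimes>\<^bsub>rook_monoid n\<^esub> x) = h \<otimes>\<^bsub>rook_monoid n\<^esub> hecke_part n x"
    unfolding hecke_part_def hv by simp
  show "rook_part n (h \<otimes>\<^bsub>rook_monoid n\<^esub> x) = rook_part n x"
    unfolding rook_part_def hv v sort_word_hecke(2)[OF u(1) len] ..
qed

lemma projective_module_hecke_algebra: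
  fixes P :: "(nat list set \<Rightarrow> complex, 'p, 'j) module_scheme"
  assumes "projective_module (rook_algebra n) P"
  shows "projective_module (hecke_algebra n) P"
proof -
  have H: "hecke_monoid n = (rook_monoid n)\<lparr>carrier := carrier (hecke_monoid n)\<rparr>"
    by (simp add: hecke_monoid_def generated_submonoid_def)
  show ?thesis
    by (subst H)
      (rule projective_module_restrict_submonoid[where a = "hecke_part n" and t = "rook_part n",
        OF monoid_rook_monoid submonoid_hecke_monoid rook_factorisation rook_factorisation_hecke assms])
qed

theorem theorem5p24:
  fixes n :: nat
  shows "projective_module (hecke_algebra n) (regular_module (rook_algebra n)) \<and>
    (\<forall>P :: (nat list set \<Rightarrow> complex, 'p) module.
       projective_module (rook_algebra n) P \<longrightarrow> projective_module (hecke_algebra n) P)"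
proof (intro conjI allI impI)
  show "projective_module (hecke_algebra n) (regular_module (rook_algebra n))"
    \<comment> \<open>The first claim is an instance of the second: the regular module is projective
      over its own algebra.\<close>
    by (intro projective_module_hecke_algebra projective_regular_module ring_monoid_algebra monoid_rook_monoid)
qed (rule projective_module_hecke_algebra)

end
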